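(* Let $A$ be a first order property of rooted trees. Then $f_A(\lambda) = \mathbb{P}_\lambda(A)$ is a real analytic function of $\lambda \in (0,\infty)$.
   Context: For $\lambda \in (0,\infty)$, $\mathbb{P}_\lambda$ denotes the law under which $X_1, X_2, \dots$ are i.i.d. Poisson($\lambda$) random variables. The sequence $(X_1,X_2,\dots)$ determines a rooted tree $T$ (the Poisson Galton–Watson tree) with nodes labelled in breadth first order (top to bottom, left to right, the root being node $1$): node $i$, if it exists, has $X_i$ children. A property $A$ is identified with the event $\{T \text{ has property } A\}$, and $f_A(\lambda) := \mathbb{P}_\lambda(A)$. A first order property is one expressible by a sentence of first order logic whose variables range over the vertices of the tree, built from the equality relation $=$, the binary parent relation $\pi(x,y)$ (true if $y$ is the parent of $x$), the constant symbol $R$ denoting the root, universal and existential quantifiers, and the usual Boolean connectives. The property holds for $T$ if the sentence is true in $T$. A function on $(0,\infty)$ is real analytic if for every $\lambda\in(0,\infty)$ there is $\delta>0$ such that it extends to a complex analytic function on the disc $\{z\in\mathbb{C}: |z-\lambda|\le\delta\}$. *)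

theory Defs
  imports "HOL-Probability.Probability" "HOL-Complex_Analysis.Complex_Analysis"
begin

subsection \<open>Rooted trees\<close>

text \<open>A pair (x, y) in \<open>parent\<close> means that y is the parent of x.\<close>

record 'v rtree =
  verts :: "'v set"
  root :: 'v
  parent :: "('v \<times> 'v) set"

definition rooted_tree :: "'v rtree \<Rightarrow> bool" where
  "rooted_tree T \<longleftrightarrow>
     root T \<in> verts T \<and>
     parent T \<subseteq> verts T \<times> verts T \<and>
     (\<forall>y. (root T, y) \<notin> parent T) \<and>
     (\<forall>x \<in> verts T - {root T}. \<exists>!y. (x, y) \<in> parent T) \<and>
     (\<forall>x \<in> verts T. (x, root T) \<in> (parent T)\<^sup>*)"

subsection \<open>First order language of rooted trees\<close>

datatype fo_term = Var nat | Rt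

datatype fo_formula =
    Eq fo_term fo_term
  | Par fo_term fo_term
  | Neg fo_formula
  | Conj fo_formula fo_formula
  | Disj fo_formula fo_formula
  | Impl fo_formula fo_formula
  | Forall nat fo_formula
  | Exists nat fo_formula

primrec term_vars :: "fo_term \<Rightarrow> nat set" where
  "term_vars (Var n) = {n}"
| "term_vars Rt = {}"

primrec free_vars :: "fo_formula \<Rightarrow> nat set" where
  "free_vars (Eq s t) = term_vars s \<union> term_vars t"
| "free_vars (Par s t) = term_vars s \<union> term_vars t"
| "free_vars (Neg \<phi>) = free_vars \<phi>"
| "free_vars (Conj \<phi> \<psi>) = free_vars \<phi> \<union> free_vars \<psi>"
| "free_vars (Disj \<phi> \<psi>) = free_vars \<phi> \<union> free_vars \<psi>"
| "free_vars (Impl \<phi> \<psi>) = free_vars \<phi> \<union> free_vars \<psi>"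
| "free_vars (Forall n \<phi>) = free_vars \<phi> - {n}"
| "free_vars (Exists n \<phi>) = free_vars \<phi> - {n}"

definition sentence :: "fo_formula \<Rightarrow> bool" where
  "sentence \<phi> \<longleftrightarrow> free_vars \<phi> = {}"

primrec term_val :: "'v rtree \<Rightarrow> (nat \<Rightarrow> 'v) \<Rightarrow> fo_term \<Rightarrow> 'v" where
  "term_val T e (Var n) = e n"
| "term_val T e Rt = root T"

primrec sat :: "'v rtree \<Rightarrow> (nat \<Rightarrow> 'v) \<Rightarrow> fo_formula \<Rightarrow> bool" where
  "sat T e (Eq s t) \<longleftrightarrow> term_val T e s = term_val T e t"
| "sat T e (Par s t) \<longleftrightarrow> (term_val T e s, term_val T e t) \<in> parent T"
| "sat T e (Neg \<phi>) \<longleftrightarrow> \<not> sat T e \<phi>"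
| "sat T e (Conj \<phi> \<psi>) \<longleftrightarrow> sat T e \<phi> \<and> sat T e \<psi>"
| "sat T e (Disj \<phi> \<psi>) \<longleftrightarrow> sat T e \<phi> \<or> sat T e \<psi>"
| "sat T e (Impl \<phi> \<psi>) \<longleftrightarrow> (sat T e \<phi> \<longrightarrow> sat T e \<psi>)"
| "sat T e (Forall n \<phi>) \<longleftrightarrow> (\<forall>v \<in> verts T. sat T (e(n := v)) \<phi>)"
| "sat T e (Exists n \<phi>) \<longleftrightarrow> (\<exists>v \<in> verts T. sat T (e(n := v)) \<phi>)"

text \<open>For a sentence the choice of the initial valuation is immaterial.\<close>

definition models :: "'v rtree \<Rightarrow> fo_formula \<Rightarrow> bool" where
  "models T \<phi> \<longleftrightarrow> sat T (\<lambda>_. root T) \<phi>"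

definition first_order_property :: "('v rtree \<Rightarrow> bool) \<Rightarrow> bool" where
  "first_order_property A \<longleftrightarrow>
     (\<exists>\<phi>. sentence \<phi> \<and> (\<forall>T. rooted_tree T \<longrightarrow> (A T \<longleftrightarrow> models T \<phi>)))"

lemma sat_cong_free_vars:
  "(\<And>n. n \<in> free_vars \<phi> \<Longrightarrow> e n = e' n) \<Longrightarrow> sat T e \<phi> = sat T e' \<phi>"
proof (induction \<phi> arbitrary: e e')
  case (Eq s t)
  then show ?case by (cases s; cases t) auto
next
  case (Par s t)
  then show ?case by (cases s; cases t) auto
next
  case (Neg \<phi>)
  from Neg.IH[of e e'] Neg.prems show ?case by simp
next
  case (Conj \<phi> \<psi>)
  from Conj.IH(1)[of e e'] Conj.IH(2)[of e e'] Conj.prems show ?case by simp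
next
  case (Disj \<phi> \<psi>)
  from Disj.IH(1)[of e e'] Disj.IH(2)[of e e'] Disj.prems show ?case by simp
next
  case (Impl \<phi> \<psi>)
  from Impl.IH(1)[of e e'] Impl.IH(2)[of e e'] Impl.prems show ?case by simp
next
  case (Forall n \<phi>)
  have "sat T (e(n := v)) \<phi> = sat T (e'(n := v)) \<phi>" for v
    by (rule Forall.IH) (use Forall.prems in auto)
  then show ?case by simp
next
  case (Exists n \<phi>)
  have "sat T (e(n := v)) \<phi> = sat T (e'(n := v)) \<phi>" for v
    by (rule Exists.IH) (use Exists.prems in auto)
  then show ?case by simp
qed

lemma sentence_sat_iff_models: "sentence \<phi> \<Longrightarrow> sat T e \<phi> \<longleftrightarrow> models T \<phi>"
  unfolding models_def sentence_def by (rule sat_cong_free_vars) simp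

subsection \<open>The Poisson Galton-Watson tree\<close>

text \<open>
  Nodes are labelled from 1 in breadth first order. The nodes before node i have
  \<open>\<Sum>k = 1..<i. x k\<close> children, so together with the root these use up the labels
  up to \<open>1 + (\<Sum>k = 1..<i. x k)\<close>; the children of node i get the next \<open>x i\<close> labels.
\<close>

definition bfs_child :: "(nat \<Rightarrow> nat) \<Rightarrow> nat \<Rightarrow> nat \<Rightarrow> bool" where
  "bfs_child x i j \<longleftrightarrow> 1 + (\<Sum>k = 1..<i. x k) < j \<and> j \<le> 1 + (\<Sum>k = 1..i. x k)"

inductive_set bfs_nodes :: "(nat \<Rightarrow> nat) \<Rightarrow> nat set" for x where
  root: "1 \<in> bfs_nodes x"
| child: "i \<in> bfs_nodes x \<Longrightarrow> bfs_child x i j \<Longrightarrow> j \<in> bfs_nodes x"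

definition bfs_tree :: "(nat \<Rightarrow> nat) \<Rightarrow> nat rtree" where
  "bfs_tree x =
     \<lparr>verts = bfs_nodes x, root = 1, parent = {(j, i). i \<in> bfs_nodes x \<and> bfs_child x i j}\<rparr>"

definition poisson_law :: "real \<Rightarrow> (nat \<Rightarrow> nat) measure" where
  "poisson_law lam = (\<Pi>\<^sub>M i\<in>{1..}. measure_pmf (poisson_pmf lam))"

definition prob_property :: "(nat rtree \<Rightarrow> bool) \<Rightarrow> real \<Rightarrow> real" where
  "prob_property A lam =
     measure (poisson_law lam) {x \<in> space (poisson_law lam). A (bfs_tree x)}"

subsection \<open>Real analytic functions\<close>

definition real_analytic_on :: "(real \<Rightarrow> real) \<Rightarrow> real set \<Rightarrow> bool" where
  "real_analytic_on f S \<longleftrightarrow>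
     (\<forall>a \<in> S. \<exists>\<delta>>0. \<exists>g. g analytic_on cball (complex_of_real a) \<delta> \<and>
        (\<forall>t \<in> S. complex_of_real t \<in> cball (complex_of_real a) \<delta> \<longrightarrow>
           g (complex_of_real t) = complex_of_real (f t)))"

subsection \<open>The tree is a rooted tree and first order properties are events\<close>

lemma bfs_nodes_bound: "i \<in> bfs_nodes x \<Longrightarrow> 1 \<le> i \<and> i \<le> 1 + (\<Sum>k = 1..<i. x k)"
proof (induction rule: bfs_nodes.induct)
  case root
  show ?case by simp
next
  case (child i j)
  then have "i < j" by (auto simp: bfs_child_def)
  then have "(\<Sum>k = 1..i. x k) \<le> (\<Sum>k = 1..<j. x k)"
    by (intro sum_mono2) auto
  with child show ?case by (auto simp: bfs_child_def)
qed

lemma bfs_child_less: "i \<in> bfs_nodes x \<Longrightarrow> bfs_child x i j \<Longrightarrow> i < j"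
  using bfs_nodes_bound[of i x] by (auto simp: bfs_child_def)

lemma bfs_child_unique: "bfs_child x i j \<Longrightarrow> bfs_child x i' j \<Longrightarrow> i = i'"
proof (induction i i' rule: linorder_wlog)
  case (le a b)
  show ?case
  proof (rule ccontr)
    assume "a \<noteq> b"
    with le have "(\<Sum>k = 1..a. x k) \<le> (\<Sum>k = 1..<b. x k)"
      by (intro sum_mono2) auto
    with le show False by (auto simp: bfs_child_def)
  qed
next
  case (sym a b)
  then show ?case by auto
qed

lemma bfs_nodes_iff:
  "j \<in> bfs_nodes x \<longleftrightarrow> j = 1 \<or> (\<exists>i<j. i \<in> bfs_nodes x \<and> bfs_child x i j)"
  using bfs_child_less[of _ x j] by (metis bfs_nodes.simps)

lemma rooted_tree_bfs_tree: "rooted_tree (bfs_tree x)"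
proof -
  have no_parent: "\<not> bfs_child x i 1" for i
    by (auto simp: bfs_child_def)
  have reach: "(j, 1) \<in> (parent (bfs_tree x))\<^sup>*" if "j \<in> bfs_nodes x" for j
    using that
  proof (induction rule: bfs_nodes.induct)
    case (child i j)
    then have "(j, i) \<in> parent (bfs_tree x)" by (simp add: bfs_tree_def)
    with child show ?case by (meson converse_rtrancl_into_rtrancl)
  qed simp
  have uniq: "\<exists>!i. i \<in> bfs_nodes x \<and> bfs_child x i j" if "j \<in> bfs_nodes x" "j \<noteq> 1" for j
    using that bfs_nodes_iff[of j x] bfs_child_unique[of x _ j] by blast
  show ?thesis
    unfolding rooted_tree_def
    using no_parent reach uniq bfs_nodes.root
    by (auto simp: bfs_tree_def intro: bfs_nodes.child)
qed

lemma space_poisson_law: "space (poisson_law lam) = ({1..} \<rightarrow>\<^sub>E UNIV)"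
  by (simp add: poisson_law_def space_PiM)

lemma measurable_offspring:
  "1 \<le> k \<Longrightarrow> (\<lambda>x. x k) \<in> measurable (poisson_law lam) (count_space UNIV)"
  unfolding poisson_law_def
  using measurable_component_singleton[of k "{1..}" "\<lambda>_. measure_pmf (poisson_pmf lam)"]
  by simp

lemma measurable_bfs_child [measurable]:
  "Measurable.pred (poisson_law lam) (\<lambda>x. bfs_child x i j)"
proof -
  have *: "(\<lambda>x. \<Sum>k\<in>K. x k) \<in> measurable (poisson_law lam) (count_space UNIV)"
    if "K \<subseteq> {1..}" for K
    using that by (intro measurable_sum_nat measurable_offspring) auto
  have [measurable]: "(\<lambda>x. \<Sum>k = 1..<i. x k) \<in> measurable (poisson_law lam) (count_space UNIV)"
    "(\<lambda>x. \<Sum>k = 1..i. x k) \<in> measurable (poisson_law lam) (count_space UNIV)"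
    by (rule *; auto)+
  show ?thesis unfolding bfs_child_def by measurable
qed

lemma measurable_bfs_nodes [measurable]:
  "Measurable.pred (poisson_law lam) (\<lambda>x. j \<in> bfs_nodes x)"
proof (induction j rule: less_induct)
  case (less j)
  have *: "Measurable.pred (poisson_law lam)
      (\<lambda>x. i < j \<and> i \<in> bfs_nodes x \<and> bfs_child x i j)" for i
  proof (cases "i < j")
    case True
    from less[OF this] measurable_bfs_child True show ?thesis by simp
  qed simp
  have "Measurable.pred (poisson_law lam)
      (\<lambda>x. j = 1 \<or> (\<exists>i. i < j \<and> i \<in> bfs_nodes x \<and> bfs_child x i j))"
    by (intro pred_intros_logic(5) pred_intros_countable(2) *) simp
  moreover have "(\<lambda>x. j = 1 \<or> (\<exists>i. i < j \<and> i \<in> bfs_nodes x \<and> bfs_child x i j)) =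
      (\<lambda>x. j \<in> bfs_nodes x)"
    by (rule ext, rule bfs_nodes_iff[symmetric])
  ultimately show ?case by (rule back_subst)
qed

lemma measurable_sat_bfs_tree:
  "Measurable.pred (poisson_law lam) (\<lambda>x. sat (bfs_tree x) e \<phi>)"
proof (induction \<phi> arbitrary: e)
  case (Eq s t)
  then show ?case by (cases s; cases t) (auto simp: bfs_tree_def)
next
  case (Par s t)
  then show ?case by (cases s; cases t) (auto simp: bfs_tree_def)
next
  case (Forall n \<phi>)
  note [measurable] = Forall.IH
  have "Measurable.pred (poisson_law lam)
          (\<lambda>x. \<forall>v. v \<in> bfs_nodes x \<longrightarrow> sat (bfs_tree x) (e(n := v)) \<phi>)"
    by measurable
  then show ?case by (simp add: bfs_tree_def Ball_def)
next
  case (Exists n \<phi>)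
  note [measurable] = Exists.IH
  have "Measurable.pred (poisson_law lam)
          (\<lambda>x. \<exists>v. v \<in> bfs_nodes x \<and> sat (bfs_tree x) (e(n := v)) \<phi>)"
    by measurable
  then show ?case by (simp add: bfs_tree_def Bex_def)
qed simp_all

lemma first_order_property_event:
  assumes "first_order_property A"
  shows "{x \<in> space (poisson_law lam). A (bfs_tree x)} \<in> sets (poisson_law lam)"
proof -
  obtain \<phi> where "\<And>x. A (bfs_tree x) \<longleftrightarrow> models (bfs_tree x) \<phi>"
    using assms rooted_tree_bfs_tree unfolding first_order_property_def by metis
  moreover have "models (bfs_tree x) \<phi> \<longleftrightarrow> sat (bfs_tree x) (\<lambda>_. 1) \<phi>" for x
    by (simp add: models_def bfs_tree_def)
  ultimately show ?thesis
    using measurable_sat_bfs_tree[where e = "\<lambda>_. 1" and \<phi> = \<phi> and lam = lam] by (simp add: pred_def)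
qed

end

theory Submission
  imports Defs
begin

text \<open>
  Ehrenfeucht games in which the players have to stay near the vertices already chosen show
  that for every sentence there is a finite tree \<open>U\<close> such that among the trees having a vertex
  whose tree of descendants is \<open>U\<close>, the truth of the sentence is determined by a ball of
  radius \<open>r\<close> about the root. A tree without such a vertex is almost surely finite. Hence, up to
  sign, the probability is the sum of three series of functions
  $e^{-n\lambda} \lambda^k / c$: one over possible balls of radius \<open>r\<close>, two over finite trees
  avoiding \<open>U\<close>. Replacing \<open>\<lambda>\<close> by a complex number near \<open>\<lambda>\<close> costs a factor
  \<open>s\<close> close to 1 for each vertex. The generating function of the trees avoiding \<open>U\<close>,
  with \<open>s\<close> marking vertices, remains at most 1 as long as \<open>s - 1\<close> is at most
  the probability of \<open>U\<close> (up to boundary effects), so the series converge locally uniformly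
  on a complex neighbourhood.
\<close>

subsection \<open>The local game\<close>


text \<open>The obstacle is convergence off the real axis. A series over all finite trees will not
  do: above rate 1 it misses the infinite trees, and at rate 1 the size of the tree has no
  exponential moment, so that every factor \<open>s\<close> > 1 per vertex makes the series diverge.
  The infinite trees must therefore be judged by finitely many levels. \<open>U\<close> achieves
  this by containing, many times over, a copy of every local situation that a vertex away from the
  root can have; a move far from all chosen vertices can then always be answered inside
  \<open>U\<close>, and only the surroundings of the root can tell two trees containing
  \<open>U\<close> apart. The number of situations is finite although degrees are unbounded, because
  a bounded number of moves can only count up to a bounded multiplicity. The three series come from
  comparing the property P of the sentence with a property Q of the ball that agrees with P on all
  trees containing \<open>U\<close>: the probability of P is that of Q, plus that of P without Q,
  minus that of Q without P, and both differences live on trees without \<open>U\<close>.\<close>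

fun ldist :: "nat list \<Rightarrow> nat list \<Rightarrow> nat" where
  "ldist [] q = length q"
| "ldist (a # p) [] = Suc (length p)"
| "ldist (a # p) (b # q) = (if a = b then ldist p q else Suc (Suc (length p + length q)))"

lemma ldist_Nil2 [simp]: "ldist p [] = length p"
  by (cases p) auto

lemma ldist_commute: "ldist p q = ldist q p"
  by (induction p q rule: ldist.induct) auto

lemma ldist_le_length: "ldist p q \<le> length p + length q"
  by (induction p q rule: ldist.induct) auto

lemma length_le_ldist: "length p \<le> length q + ldist p q"
  by (induction p q rule: ldist.induct) auto

lemma ldist_eq_0_iff: "ldist p q = 0 \<longleftrightarrow> p = q"
  by (induction p q rule: ldist.induct) auto

lemma ldist_triangle: "ldist p r \<le> ldist p q + ldist q r"
proof (induction p r arbitrary: q rule: ldist.induct)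
  case (1 r)
  then show ?case using length_le_ldist[of r q] by (simp add: ldist_commute)
next
  case (2 a p)
  then show ?case using length_le_ldist[of "a # p" q] by simp
next
  case (3 a p b r)
  show ?case
  proof (cases q)
    case Nil
    then show ?thesis using ldist_le_length[of p r] by auto
  next
    case (Cons c q')
    have "length p \<le> length q' + ldist p q'" "length r \<le> length q' + ldist q' r"
      using length_le_ldist[of p q'] length_le_ldist[of r q'] by (simp_all add: ldist_commute)
    then show ?thesis using 3[of q'] Cons ldist_le_length[of p r] by auto
  qed
qed

lemma ldist_append [simp]: "ldist (a @ p) (a @ q) = ldist p q"
  by (induction a) auto

lemma ldist_snoc: "ldist p (p @ [i]) = 1"
  by (induction p) auto

text \<open>\<open>ldist\<close> is the graph distance in the tree of all addresses. A path from
  \<open>a @ p\<close> that leaves the descendants of \<open>a\<close> must climb the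
  \<open>length p\<close> edges up to \<open>a\<close> and then one more.\<close>

lemma ldist_append_le_length:
  "ldist (a @ p) c \<le> length p \<Longrightarrow> \<exists>p'. c = a @ p'"
proof (induction a arbitrary: c)
  case (Cons x a)
  then show ?case by (cases c) (auto split: if_splits)
qed auto

section \<open>Transfer of truth along isomorphisms, and trees as sets of addresses\<close>

lemma sat_isomorphic:
  assumes bij: "bij_betw f (verts T) (verts T')"
    and rt: "root T \<in> verts T" "f (root T) = root T'"
    and par: "\<And>u v. u \<in> verts T \<Longrightarrow> v \<in> verts T \<Longrightarrow> (f u, f v) \<in> parent T' \<longleftrightarrow> (u, v) \<in> parent T"
    and e: "range e \<subseteq> verts T"
  shows "sat T' (\<lambda>k. f (e k)) \<phi> \<longleftrightarrow> sat T e \<phi>"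
  using e
proof (induction \<phi> arbitrary: e)
  case (Eq s t)
  have "term_val T e u \<in> verts T" "term_val T' (\<lambda>k. f (e k)) u = f (term_val T e u)" for u
    using Eq rt by (cases u; auto)+
  then show ?case using bij unfolding sat.simps by (metis bij_betw_def inj_on_eq_iff)
next
  case (Par s t)
  have "term_val T e u \<in> verts T" "term_val T' (\<lambda>k. f (e k)) u = f (term_val T e u)" for u
    using Par rt by (cases u; auto)+
  then show ?case unfolding sat.simps using par by metis
next
  case (Forall n \<phi>)
  have "sat T' ((\<lambda>k. f (e k))(n := f v)) \<phi> \<longleftrightarrow> sat T (e(n := v)) \<phi>" if "v \<in> verts T" for v
  proof -
    have "(\<lambda>k. f (e k))(n := f v) = (\<lambda>k. f ((e(n := v)) k))" by auto
    moreover have "range (e(n := v)) \<subseteq> verts T" using Forall.prems that by auto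
    ultimately show ?thesis using Forall.IH by metis
  qed
  moreover have "verts T' = f ` verts T" using bij by (simp add: bij_betw_def)
  ultimately show ?case by (simp del: fun_upd_apply)
next
  case (Exists n \<phi>)
  have "sat T' ((\<lambda>k. f (e k))(n := f v)) \<phi> \<longleftrightarrow> sat T (e(n := v)) \<phi>" if "v \<in> verts T" for v
  proof -
    have "(\<lambda>k. f (e k))(n := f v) = (\<lambda>k. f ((e(n := v)) k))" by auto
    moreover have "range (e(n := v)) \<subseteq> verts T" using Exists.prems that by auto
    ultimately show ?thesis using Exists.IH by metis
  qed
  moreover have "verts T' = f ` verts T" using bij by (simp add: bij_betw_def)
  ultimately show ?case by (simp del: fun_upd_apply)
qed auto

text \<open>Placing all trees inside one fixed tree of addresses makes balls about the root, and
  subtrees below two vertices, comparable as plain sets. The order of siblings is visible in the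
  addresses but not in \<open>parent\<close>.\<close>

definition addr_tree :: "nat list set \<Rightarrow> nat list rtree" where
  "addr_tree S = \<lparr>verts = S, root = [], parent = {(a, b). a \<in> S \<and> b \<in> S \<and> (\<exists>i. a = b @ [i])}\<rparr>"

text \<open>Positions are sets of pairs, so that the order of the moves is immaterial.\<close>

definition same_atoms :: "nat list \<Rightarrow> nat list \<Rightarrow> nat list \<Rightarrow> nat list \<Rightarrow> bool" where
  "same_atoms a a' b b' \<longleftrightarrow> (a = a' \<longleftrightarrow> b = b') \<and> ((\<exists>i. a = a' @ [i]) \<longleftrightarrow> (\<exists>i. b = b' @ [i]))"

text \<open>With \<open>Suc q\<close> moves left a move has reach \<open>2 ^ q\<close>; the reaches
  of this and all later moves sum to less than \<open>2 ^ Suc q\<close>, which is the origin of all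
  distances below. The conjunct \<open>local_game q S S' P\<close> allows a move to be skipped, so
  that a strategy for more moves yields one for fewer.\<close>

primrec local_game :: "nat \<Rightarrow> nat list set \<Rightarrow> nat list set \<Rightarrow> (nat list \<times> nat list) set \<Rightarrow> bool" where
  "local_game 0 S S' P \<longleftrightarrow> (\<forall>(a, b) \<in> P. \<forall>(a', b') \<in> P. same_atoms a a' b b')"
| "local_game (Suc q) S S' P \<longleftrightarrow> local_game q S S' P \<and> (\<forall>(a, b) \<in> P.
     (\<forall>c\<in>S. ldist a c \<le> 2 ^ q \<longrightarrow>
        (\<exists>c'\<in>S'. ldist b c' \<le> 2 ^ q \<and> local_game q S S' (insert (c, c') P))) \<and>
     (\<forall>c'\<in>S'. ldist b c' \<le> 2 ^ q \<longrightarrow>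
        (\<exists>c\<in>S. ldist a c \<le> 2 ^ q \<and> local_game q S S' (insert (c, c') P))))"

lemma local_game_0I:
  "(\<And>a b a' b'. (a, b) \<in> P \<Longrightarrow> (a', b') \<in> P \<Longrightarrow> same_atoms a a' b b') \<Longrightarrow> local_game 0 S S' P"
  by auto

lemma local_game_0D:
  "local_game 0 S S' P \<Longrightarrow> (a, b) \<in> P \<Longrightarrow> (a', b') \<in> P \<Longrightarrow> same_atoms a a' b b'"
  by auto

lemma same_atoms_converse: "same_atoms a a' b b' \<Longrightarrow> same_atoms b b' a a'"
  unfolding same_atoms_def by simp

lemma same_atoms_trans: "same_atoms a a' b b' \<Longrightarrow> same_atoms b b' c c' \<Longrightarrow> same_atoms a a' c c'"
  unfolding same_atoms_def by simp

lemma same_atoms_far: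
  assumes "ldist a a' > 1" "ldist b b' > 1"
  shows "same_atoms a a' b b'"
  using assms ldist_snoc[of a'] ldist_snoc[of b'] ldist_eq_0_iff[of a a] ldist_eq_0_iff[of b b]
  unfolding same_atoms_def by (auto simp: ldist_commute)

lemma local_game_SucI:
  assumes "local_game q S S' P"
    and "\<And>a b c. (a, b) \<in> P \<Longrightarrow> c \<in> S \<Longrightarrow> ldist a c \<le> 2 ^ q \<Longrightarrow>
      \<exists>c'\<in>S'. ldist b c' \<le> 2 ^ q \<and> local_game q S S' (insert (c, c') P)"
    and "\<And>a b c'. (a, b) \<in> P \<Longrightarrow> c' \<in> S' \<Longrightarrow> ldist b c' \<le> 2 ^ q \<Longrightarrow>
      \<exists>c\<in>S. ldist a c \<le> 2 ^ q \<and> local_game q S S' (insert (c, c') P)"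
  shows "local_game (Suc q) S S' P"
  using assms by auto

lemma local_game_forth:
  "local_game (Suc q) S S' P \<Longrightarrow> (a, b) \<in> P \<Longrightarrow> c \<in> S \<Longrightarrow> ldist a c \<le> 2 ^ q \<Longrightarrow>
    \<exists>c'\<in>S'. ldist b c' \<le> 2 ^ q \<and> local_game q S S' (insert (c, c') P)"
  by auto

lemma local_game_back:
  "local_game (Suc q) S S' P \<Longrightarrow> (a, b) \<in> P \<Longrightarrow> c' \<in> S' \<Longrightarrow> ldist b c' \<le> 2 ^ q \<Longrightarrow>
    \<exists>c\<in>S. ldist a c \<le> 2 ^ q \<and> local_game q S S' (insert (c, c') P)"
  by auto

lemma local_game_SucD: "local_game (Suc q) S S' P \<Longrightarrow> local_game q S S' P"
  by simp

declare local_game.simps [simp del]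

lemma local_game_mono: "local_game q S S' P \<Longrightarrow> Q \<subseteq> P \<Longrightarrow> local_game q S S' Q"
proof (induction q arbitrary: P Q)
  case 0
  then show ?case by (intro local_game_0I) (meson local_game_0D subsetD)
next
  case (Suc q)
  have *: "local_game q S S' (insert (c, c') Q)" if "local_game q S S' (insert (c, c') P)" for c c'
    by (rule Suc.IH[OF that]) (use Suc.prems in auto)
  show ?case
  proof (rule local_game_SucI)
    show "local_game q S S' Q" using Suc.IH[OF local_game_SucD] Suc.prems by blast
  next
    fix a b c assume "(a, b) \<in> Q" and c: "c \<in> S" "ldist a c \<le> 2 ^ q"
    with Suc.prems have "(a, b) \<in> P" by auto
    from local_game_forth[OF Suc.prems(1) this c]
    show "\<exists>c'\<in>S'. ldist b c' \<le> 2 ^ q \<and> local_game q S S' (insert (c, c') Q)" using * by blast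
  next
    fix a b c' assume "(a, b) \<in> Q" and c: "c' \<in> S'" "ldist b c' \<le> 2 ^ q"
    with Suc.prems have "(a, b) \<in> P" by auto
    from local_game_back[OF Suc.prems(1) this c]
    show "\<exists>c\<in>S. ldist a c \<le> 2 ^ q \<and> local_game q S S' (insert (c, c') Q)" using * by blast
  qed
qed

lemma local_game_converse: "local_game q S S' P \<Longrightarrow> local_game q S' S (P\<inverse>)"
proof (induction q arbitrary: P)
  case 0
  then show ?case by (intro local_game_0I same_atoms_converse[OF local_game_0D[OF 0]]) auto
next
  case (Suc q)
  have *: "local_game q S' S (insert (c', c) (P\<inverse>))" if "local_game q S S' (insert (c, c') P)" for c c'
  proof -
    have "(insert (c, c') P)\<inverse> = insert (c', c) (P\<inverse>)" by auto
    then show ?thesis using Suc.IH[OF that] by simp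
  qed
  show ?case
  proof (rule local_game_SucI)
    show "local_game q S' S (P\<inverse>)" using Suc.IH[OF local_game_SucD] Suc.prems by blast
  next
    fix a b c assume "(a, b) \<in> P\<inverse>" "c \<in> S'" "ldist a c \<le> 2 ^ q"
    then have "\<exists>c'\<in>S. ldist b c' \<le> 2 ^ q \<and> local_game q S S' (insert (c', c) P)"
      by (intro local_game_back[OF Suc.prems]) auto
    then show "\<exists>c'\<in>S. ldist b c' \<le> 2 ^ q \<and> local_game q S' S (insert (c, c') (P\<inverse>))" using * by blast
  next
    fix a b c' assume "(a, b) \<in> P\<inverse>" "c' \<in> S" "ldist b c' \<le> 2 ^ q"
    then have "\<exists>c\<in>S'. ldist a c \<le> 2 ^ q \<and> local_game q S S' (insert (c', c) P)"
      by (intro local_game_forth[OF Suc.prems]) auto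
    then show "\<exists>c\<in>S'. ldist a c \<le> 2 ^ q \<and> local_game q S' S (insert (c, c') (P\<inverse>))" using * by blast
  qed
qed

lemma local_game_trans:
  "local_game q S S' P \<Longrightarrow> local_game q S' S'' Q \<Longrightarrow> local_game q S S'' (P O Q)"
proof (induction q arbitrary: P Q)
  case 0
  show ?case
  proof (rule local_game_0I)
    fix a c a' c' assume "(a, c) \<in> P O Q" "(a', c') \<in> P O Q"
    then obtain b b' where "(a, b) \<in> P" "(b, c) \<in> Q" "(a', b') \<in> P" "(b', c') \<in> Q"
      by auto
    with 0 show "same_atoms a a' c c'"
      by (meson local_game_0D same_atoms_trans)
  qed
next
  case (Suc q)
  \<comment> \<open>Composing the two enlarged relations can create further pairs; monotonicity
    discards them.\<close>
  have *: "local_game q S S'' (insert (x, z) (P O Q))"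
    if "local_game q S S' (insert (x, y) P)" "local_game q S' S'' (insert (y, z) Q)" for x y z
    by (rule local_game_mono[OF Suc.IH[OF that]]) auto
  show ?case
  proof (rule local_game_SucI)
    show "local_game q S S'' (P O Q)" using Suc.IH[OF local_game_SucD local_game_SucD] Suc.prems by blast
  next
    fix a d c assume "(a, d) \<in> P O Q" and c: "c \<in> S" "ldist a c \<le> 2 ^ q"
    then obtain b where b: "(a, b) \<in> P" "(b, d) \<in> Q" by auto
    obtain c' where c': "c' \<in> S'" "ldist b c' \<le> 2 ^ q" "local_game q S S' (insert (c, c') P)"
      using local_game_forth[OF Suc.prems(1) b(1) c] by blast
    obtain c'' where "c'' \<in> S''" "ldist d c'' \<le> 2 ^ q" "local_game q S' S'' (insert (c', c'') Q)"
      using local_game_forth[OF Suc.prems(2) b(2) c'(1,2)] by blast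
    then show "\<exists>c'\<in>S''. ldist d c' \<le> 2 ^ q \<and> local_game q S S'' (insert (c, c') (P O Q))"
      using * c' by blast
  next
    fix a d c assume "(a, d) \<in> P O Q" and c: "c \<in> S''" "ldist d c \<le> 2 ^ q"
    then obtain b where b: "(a, b) \<in> P" "(b, d) \<in> Q" by auto
    obtain c' where c': "c' \<in> S'" "ldist b c' \<le> 2 ^ q" "local_game q S' S'' (insert (c', c) Q)"
      using local_game_back[OF Suc.prems(2) b(2) c] by blast
    have "\<exists>c''\<in>S. ldist a c'' \<le> 2 ^ q \<and> local_game q S S' (insert (c'', c') P)"
      by (rule local_game_back[OF Suc.prems(1) b(1) c'(1,2)])
    then show "\<exists>c'\<in>S. ldist a c' \<le> 2 ^ q \<and> local_game q S S'' (insert (c', c) (P O Q))"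
      using * c' by blast
  qed
qed

lemma ldist_far:
  assumes "ldist a a' > 2 ^ Suc q" "ldist a c \<le> 2 ^ q"
  shows "ldist c a' > 2 ^ q"
  using assms ldist_triangle[of a a' c] by simp

text \<open>Two strategies are played side by side, each move being answered in the component that
  it is near. The reach \<open>2 ^ q\<close> is half of the separation \<open>2 ^ Suc q\<close>, so
  the components remain more than \<open>2 ^ q\<close> apart, which is the hypothesis with one move
  fewer.\<close>

lemma local_game_Un_far:
  assumes "local_game q S S' P" "local_game q S S' Q"
    and "\<And>a b a' b'. (a, b) \<in> P \<Longrightarrow> (a', b') \<in> Q \<Longrightarrow> ldist a a' > 2 ^ q \<and> ldist b b' > 2 ^ q"
  shows "local_game q S S' (P \<union> Q)"
  using assms
proof (induction q arbitrary: P Q)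
  case 0
  show ?case
  proof (rule local_game_0I)
    fix a b a' b' assume "(a, b) \<in> P \<union> Q" "(a', b') \<in> P \<union> Q"
    then consider "(a, b) \<in> P" "(a', b') \<in> P" | "(a, b) \<in> Q" "(a', b') \<in> Q"
      | "(a, b) \<in> P" "(a', b') \<in> Q" | "(a', b') \<in> P" "(a, b) \<in> Q"
      by blast
    then show "same_atoms a a' b b'"
    proof cases
      \<comment> \<open>A separation above \<open>2 ^ 0 = 1\<close> on both sides excludes equality
        and parenthood between the components.\<close>
      case 3
      then show ?thesis using 0(3)[of a b a' b'] by (intro same_atoms_far) auto
    next
      case 4
      then show ?thesis using 0(3)[of a' b' a b] by (intro same_atoms_far) (auto simp: ldist_commute)
    qed (use 0(1,2) local_game_0D in blast)+
  qed
next
  case (Suc q)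
  define far where "far P Q \<longleftrightarrow> (\<forall>(a, b) \<in> P. \<forall>(a', b') \<in> Q. ldist a a' > 2 ^ q \<and> ldist b b' > 2 ^ q)"
    for P Q
  have farD: "far P Q \<Longrightarrow> (a, b) \<in> P \<Longrightarrow> (a', b') \<in> Q \<Longrightarrow> ldist a a' > 2 ^ q \<and> ldist b b' > 2 ^ q"
    for P Q a b a' b' unfolding far_def by auto
  have half: "(2::nat) ^ q < k" if "2 ^ Suc q < k" for k
    using that by auto
  have far: "far P Q" using Suc.prems(3) half unfolding far_def by blast
  have step: "far (insert (c, c') P) Q"
    if "(a, b) \<in> P" "ldist a c \<le> 2 ^ q" "ldist b c' \<le> 2 ^ q" for a b c c'
  proof -
    have "ldist c a' > 2 ^ q \<and> ldist c' b' > 2 ^ q" if "(a', b') \<in> Q" for a' b'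
      using Suc.prems(3)[OF \<open>(a, b) \<in> P\<close> that] ldist_far \<open>ldist a c \<le> 2 ^ q\<close> \<open>ldist b c' \<le> 2 ^ q\<close>
      by blast
    then show ?thesis using far unfolding far_def by blast
  qed
  have step': "far P (insert (c, c') Q)"
    if "(a, b) \<in> Q" "ldist a c \<le> 2 ^ q" "ldist b c' \<le> 2 ^ q" for a b c c'
  proof -
    have "ldist a' c > 2 ^ q \<and> ldist b' c' > 2 ^ q" if "(a', b') \<in> P" for a' b'
      using Suc.prems(3)[OF that \<open>(a, b) \<in> Q\<close>] ldist_far[OF _ \<open>ldist a c \<le> 2 ^ q\<close>, of a']
        ldist_far[OF _ \<open>ldist b c' \<le> 2 ^ q\<close>, of b']
      by (auto simp: ldist_commute[of a' a] ldist_commute[of a' c] ldist_commute[of b' b] ldist_commute[of b' c'])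
    then show ?thesis using far unfolding far_def by blast
  qed
  have IH: "local_game q S S' (P \<union> Q)" if "local_game q S S' P" "local_game q S S' Q" "far P Q" for P Q
    using Suc.IH[OF that(1,2)] farD[OF that(3)] by blast
  have ext: "local_game q S S' (insert (c, c') (P \<union> Q))"
    if "local_game q S S' (insert (c, c') P)" "(a, b) \<in> P" "ldist a c \<le> 2 ^ q" "ldist b c' \<le> 2 ^ q" for a b c c'
    using IH[OF that(1) local_game_SucD[OF Suc.prems(2)] step[OF that(2-4)]] by simp
  have ext': "local_game q S S' (insert (c, c') (P \<union> Q))"
    if "local_game q S S' (insert (c, c') Q)" "(a, b) \<in> Q" "ldist a c \<le> 2 ^ q" "ldist b c' \<le> 2 ^ q" for a b c c'
    using IH[OF local_game_SucD[OF Suc.prems(1)] that(1) step'[OF that(2-4)]] by simp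
  show ?case
  proof (rule local_game_SucI)
    show "local_game q S S' (P \<union> Q)" using IH[OF local_game_SucD local_game_SucD far] Suc.prems by blast
  next
    fix a b c assume ab: "(a, b) \<in> P \<union> Q" and c: "c \<in> S" "ldist a c \<le> 2 ^ q"
    from ab show "\<exists>c'\<in>S'. ldist b c' \<le> 2 ^ q \<and> local_game q S S' (insert (c, c') (P \<union> Q))"
    proof
      assume "(a, b) \<in> P"
      then show ?thesis using local_game_forth[OF Suc.prems(1) _ c] c ext by blast
    next
      assume "(a, b) \<in> Q"
      then show ?thesis using local_game_forth[OF Suc.prems(2) _ c] c ext' by blast
    qed
  next
    fix a b c' assume ab: "(a, b) \<in> P \<union> Q" and c: "c' \<in> S'" "ldist b c' \<le> 2 ^ q"
    from ab show "\<exists>c\<in>S. ldist a c \<le> 2 ^ q \<and> local_game q S S' (insert (c, c') (P \<union> Q))"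
    proof
      assume *: "(a, b) \<in> P"
      then have "\<exists>c\<in>S. ldist a c \<le> 2 ^ q \<and> local_game q S S' (insert (c, c') P)"
        using local_game_back[OF Suc.prems(1) _ c] by blast
      then show ?thesis using c ext[OF _ *] by blast
    next
      assume *: "(a, b) \<in> Q"
      then have "\<exists>c\<in>S. ldist a c \<le> 2 ^ q \<and> local_game q S S' (insert (c, c') Q)"
        using local_game_back[OF Suc.prems(2) _ c] by blast
      then show ?thesis using c ext'[OF _ *] by blast
    qed
  qed
qed


text \<open>The reply to \<open>a @ p\<close> is \<open>v @ p\<close>. A chosen vertex needs
  clearance \<open>2 ^ q\<close> from depth \<open>H\<close>, beyond which the copies may differ,
  and from \<open>a\<close>, above which nothing is known; at the root itself there is no way up. A
  move of reach \<open>2 ^ q\<close> uses up half of a clearance \<open>2 ^ Suc q\<close>.\<close>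

lemma local_game_copy:
  assumes "\<And>p. length p \<le> H \<Longrightarrow> a @ p \<in> S \<longleftrightarrow> v @ p \<in> S'"
    and "P \<subseteq> {(a @ p, v @ p) | p. (a = [] \<and> v = [] \<or> 2 ^ q \<le> length p) \<and> length p + 2 ^ q \<le> H}"
  shows "local_game q S S' P"
  using assms(2)
proof (induction q arbitrary: P)
  case 0
  show ?case
  proof (rule local_game_0I)
    fix x y x' y' assume "(x, y) \<in> P" "(x', y') \<in> P"
    then obtain p p' where "x = a @ p" "y = v @ p" "x' = a @ p'" "y' = v @ p'"
      using 0 by blast
    then show "same_atoms x x' y y'" by (simp add: same_atoms_def)
  qed
next
  case (Suc q)
  have move: "\<exists>p'. c = u @ p' \<and> (a = [] \<and> v = [] \<or> 2 ^ q \<le> length p') \<and> length p' + 2 ^ q \<le> H"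
    if "ldist (u @ p) c \<le> 2 ^ q" "a = [] \<and> v = [] \<or> 2 ^ Suc q \<le> length p" "length p + 2 ^ Suc q \<le> H"
      "u = a \<or> u = v" for u p c
  proof -
    have "\<exists>p'. c = u @ p'"
      using that ldist_append_le_length[of u p c] by fastforce
    then obtain p' where p': "c = u @ p'" by blast
    with that(1) have "ldist p p' \<le> 2 ^ q" by simp
    then have "length p \<le> length p' + 2 ^ q" "length p' \<le> length p + 2 ^ q"
      using length_le_ldist[of p p'] length_le_ldist[of p' p] ldist_commute[of p p'] by linarith+
    with that p' show ?thesis by auto
  qed
  have P: "\<exists>p. x = a @ p \<and> y = v @ p \<and> (a = [] \<and> v = [] \<or> 2 ^ Suc q \<le> length p) \<and> length p + 2 ^ Suc q \<le> H"
    if "(x, y) \<in> P" for x y using Suc.prems that by blast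
  have sub: "P \<subseteq> {(a @ p, v @ p) | p. (a = [] \<and> v = [] \<or> 2 ^ q \<le> length p) \<and> length p + 2 ^ q \<le> H}"
  proof safe
    fix x y assume "(x, y) \<in> P"
    from P[OF this] show "\<exists>p. (x, y) = (a @ p, v @ p) \<and> (a = [] \<and> v = [] \<or> 2 ^ q \<le> length p) \<and> length p + 2 ^ q \<le> H"
      by auto
  qed
  have ext: "local_game q S S' (insert (a @ p, v @ p) P)"
    if "a = [] \<and> v = [] \<or> 2 ^ q \<le> length p" "length p + 2 ^ q \<le> H" for p
    by (rule Suc.IH) (use sub that in blast)
  show ?case
  proof (rule local_game_SucI)
    show "local_game q S S' P" by (rule Suc.IH[OF sub])
  next
    fix x y c assume xy: "(x, y) \<in> P" and c: "c \<in> S" "ldist x c \<le> 2 ^ q"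
    from P[OF xy] obtain p where p: "x = a @ p" "y = v @ p" "a = [] \<and> v = [] \<or> 2 ^ Suc q \<le> length p" "length p + 2 ^ Suc q \<le> H"
      by blast
    from move[of a p c] p c obtain p' where p': "c = a @ p'" "a = [] \<and> v = [] \<or> 2 ^ q \<le> length p'" "length p' + 2 ^ q \<le> H"
      by blast
    have "v @ p' \<in> S'" using assms(1)[of p'] p' c by simp
    moreover have "ldist y (v @ p') \<le> 2 ^ q" using c p p' by simp
    ultimately show "\<exists>c'\<in>S'. ldist y c' \<le> 2 ^ q \<and> local_game q S S' (insert (c, c') P)"
      using ext[OF p'(2,3)] p'(1) by blast
  next
    fix x y c assume xy: "(x, y) \<in> P" and c: "c \<in> S'" "ldist y c \<le> 2 ^ q"
    from P[OF xy] obtain p where p: "x = a @ p" "y = v @ p" "a = [] \<and> v = [] \<or> 2 ^ Suc q \<le> length p" "length p + 2 ^ Suc q \<le> H"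
      by blast
    from move[of v p c] p c obtain p' where p': "c = v @ p'" "a = [] \<and> v = [] \<or> 2 ^ q \<le> length p'" "length p' + 2 ^ q \<le> H"
      by blast
    have "a @ p' \<in> S" using assms(1)[of p'] p' c by simp
    moreover have "ldist x (a @ p') \<le> 2 ^ q" using c p p' by simp
    ultimately show "\<exists>c'\<in>S. ldist x c' \<le> 2 ^ q \<and> local_game q S S' (insert (c', c) P)"
      using ext[OF p'(2,3)] p'(1) by blast
  qed
qed

text \<open>Taking natural numbers as values keeps the type of the classifying map fixed in the next
  induction, where each round forms sets of earlier values.\<close>

lemma finite_index_nat:
  assumes "finite (range f)"
  obtains g :: "'a \<Rightarrow> nat" where "finite (range g)" "\<And>x y. g x = g y \<Longrightarrow> f x = f y"
proof
  let ?g = "to_nat_on (range f) \<circ> f"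
  have "range ?g = to_nat_on (range f) ` range f" by auto
  then show "finite (range ?g)" using assms by simp
  show "f x = f y" if "?g x = ?g y" for x y
    using that inj_on_to_nat_on[OF countable_finite[OF assms]] by (auto dest: inj_onD)
qed

text \<open>These are local Hintikka types: for \<open>Suc q\<close> moves, a tuple is classified by
  its class for \<open>q\<close> moves and, for each entry, by the set of classes of its extensions
  by a nearby vertex. Sets forget multiplicities, so finiteness survives unbounded degrees. The
  length \<open>n\<close> has to vary because extending lengthens the tuple.\<close>

lemma local_game_finite_index:
  "\<exists>\<tau> :: nat list set \<times> nat list list \<Rightarrow> nat. finite (range \<tau>) \<and>
     (\<forall>S S' a b. length a = n \<longrightarrow> length b = n \<longrightarrow> \<tau> (S, a) = \<tau> (S', b) \<longrightarrow>
       local_game q S S' (set (zip a b)))"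
proof (induction q arbitrary: n)
  case 0
  let ?f = "\<lambda>(S :: nat list set, a :: nat list list). ({(i, j). i < n \<and> j < n \<and> a ! i = a ! j},
      {(i, j). i < n \<and> j < n \<and> (\<exists>k. a ! i = a ! j @ [k])})"
  have "range ?f \<subseteq> Pow ({..<n} \<times> {..<n}) \<times> Pow ({..<n} \<times> {..<n})" by auto
  then have "finite (range ?f)" by (rule finite_subset) simp
  then obtain \<tau> :: "nat list set \<times> nat list list \<Rightarrow> nat"
    where \<tau>: "finite (range \<tau>)" "\<And>x y. \<tau> x = \<tau> y \<Longrightarrow> ?f x = ?f y"
    by (rule finite_index_nat) (rule that)
  have "local_game 0 S S' (set (zip a b))"
    if len: "length a = n" "length b = n" and eq: "\<tau> (S, a) = \<tau> (S', b)" for S S' a b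
  proof (rule local_game_0I)
    fix x y x' y' assume "(x, y) \<in> set (zip a b)" "(x', y') \<in> set (zip a b)"
    then obtain i j where ij: "i < n" "j < n" "x = a ! i" "y = b ! i" "x' = a ! j" "y' = b ! j"
      unfolding set_zip mem_Collect_eq prod.inject using len by (metis min_less_iff_conj)
    from \<tau>(2)[OF eq]
    have "(i, j) \<in> {(i, j). i < n \<and> j < n \<and> a ! i = a ! j} \<longleftrightarrow> (i, j) \<in> {(i, j). i < n \<and> j < n \<and> b ! i = b ! j}"
      "(i, j) \<in> {(i, j). i < n \<and> j < n \<and> (\<exists>k. a ! i = a ! j @ [k])} \<longleftrightarrow>
       (i, j) \<in> {(i, j). i < n \<and> j < n \<and> (\<exists>k. b ! i = b ! j @ [k])}"
      by auto
    with ij show "same_atoms x x' y y'" unfolding same_atoms_def by simp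
  qed
  with \<tau>(1) show ?case by blast
next
  case (Suc q)
  obtain \<tau> :: "nat list set \<times> nat list list \<Rightarrow> nat" where \<tau>: "finite (range \<tau>)"
    "\<And>S S' a b. length a = n \<Longrightarrow> length b = n \<Longrightarrow> \<tau> (S, a) = \<tau> (S', b) \<Longrightarrow> local_game q S S' (set (zip a b))"
    using Suc[of n] by blast
  obtain \<tau>' :: "nat list set \<times> nat list list \<Rightarrow> nat" where \<tau>': "finite (range \<tau>')"
    "\<And>S S' a b. length a = Suc n \<Longrightarrow> length b = Suc n \<Longrightarrow> \<tau>' (S, a) = \<tau>' (S', b) \<Longrightarrow> local_game q S S' (set (zip a b))"
    using Suc[of "Suc n"] by blast
  define g where "g S a i = {\<tau>' (S, a @ [c]) | c. c \<in> S \<and> ldist (a ! i) c \<le> 2 ^ q}" for S a i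
  let ?f = "\<lambda>(S, a). (\<tau> (S, a), map (g S a) [0..<n])"
  have "range ?f \<subseteq> range \<tau> \<times> {xs. set xs \<subseteq> Pow (range \<tau>') \<and> length xs = n}"
    by (auto simp: g_def)
  then have "finite (range ?f)"
    by (rule finite_subset) (simp add: \<tau> \<tau>' finite_lists_length_eq)
  then obtain \<rho> :: "nat list set \<times> nat list list \<Rightarrow> nat"
    where \<rho>: "finite (range \<rho>)" "\<And>x y. \<rho> x = \<rho> y \<Longrightarrow> ?f x = ?f y"
    by (rule finite_index_nat) (rule that)
  have "local_game (Suc q) S S' (set (zip a b))"
    if len: "length a = n" "length b = n" and eq: "\<rho> (S, a) = \<rho> (S', b)" for S S' a b
  proof -
    have eq1: "\<tau> (S, a) = \<tau> (S', b)" and eq2: "\<And>i. i < n \<Longrightarrow> g S a i = g S' b i"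
      using \<rho>(2)[OF eq] by auto
    have zip: "set (zip (a @ [c]) (b @ [c'])) = insert (c, c') (set (zip a b))" for c c'
      using len by simp
    show ?thesis
    proof (rule local_game_SucI)
      show "local_game q S S' (set (zip a b))" by (rule \<tau>(2)[OF len eq1])
    next
      fix x y c assume "(x, y) \<in> set (zip a b)" and c: "c \<in> S" "ldist x c \<le> 2 ^ q"
      then obtain i where i: "i < n" "x = a ! i" "y = b ! i"
        using len by (auto simp: set_zip)
      have "\<tau>' (S, a @ [c]) \<in> g S' b i" using c i eq2[OF i(1)] unfolding g_def by blast
      then obtain c' where "c' \<in> S'" "ldist y c' \<le> 2 ^ q" "\<tau>' (S, a @ [c]) = \<tau>' (S', b @ [c'])"
        using i unfolding g_def by blast
      then show "\<exists>c'\<in>S'. ldist y c' \<le> 2 ^ q \<and> local_game q S S' (insert (c, c') (set (zip a b)))"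
        using \<tau>'(2)[of "a @ [c]" "b @ [c']" S S'] len zip by auto
    next
      fix x y c assume "(x, y) \<in> set (zip a b)" and c: "c \<in> S'" "ldist y c \<le> 2 ^ q"
      then obtain i where i: "i < n" "x = a ! i" "y = b ! i"
        using len by (auto simp: set_zip)
      have "\<tau>' (S', b @ [c]) \<in> g S a i" using c i eq2[OF i(1)] unfolding g_def by blast
      then obtain c' where "c' \<in> S" "ldist x c' \<le> 2 ^ q" "\<tau>' (S', b @ [c]) = \<tau>' (S, a @ [c'])"
        using i unfolding g_def by blast
      then show "\<exists>c'\<in>S. ldist x c' \<le> 2 ^ q \<and> local_game q S S' (insert (c', c) (set (zip a b)))"
        using \<tau>'(2)[of "a @ [c']" "b @ [c]" S S'] len zip by auto
    qed
  qed
  with \<rho>(1) show ?case by blast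
qed

subsection \<open>Universal trees\<close>

text \<open>This provides the replies to far moves: \<open>c\<close> is a vertex away from the root,
  and \<open>B\<close> will be the set of vertices already chosen on the other side, which the reply
  must avoid by more than the reach.\<close>

definition saturated :: "nat \<Rightarrow> nat list set \<Rightarrow> nat list set \<Rightarrow> bool" where
  "saturated m S S' \<longleftrightarrow> (\<forall>q<m. \<forall>c\<in>S. 2 ^ q < length c \<longrightarrow> (\<forall>B. finite B \<and> card B \<le> m \<longrightarrow>
     (\<exists>c'\<in>S'. (\<forall>b\<in>B. 2 ^ q < ldist b c') \<and> local_game q S S' {(c, c')})))"

text \<open>A move near the position is a legal local move. A far move is answered by saturation,
  and the new pair is glued to \<open>P\<close> as a separate component. The pair
  \<open>([], [])\<close> guarantees that a far move is also far from the root, as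
  \<open>saturated\<close> demands.\<close>

lemma local_game_extend:
  assumes "local_game (Suc q) S S' P" "([], []) \<in> P" "finite P" "card P \<le> m" "q < m"
    and "saturated m S S'" "c \<in> S"
  shows "\<exists>c'\<in>S'. local_game q S S' (insert (c, c') P)"
proof (cases "\<exists>(a, b)\<in>P. ldist a c \<le> 2 ^ q")
  case True
  then show ?thesis using local_game_forth[OF assms(1) _ assms(7)] by blast
next
  case False
  then have far: "2 ^ q < ldist c a" if "(a, b) \<in> P" for a b
    using that by (fastforce simp: ldist_commute)
  from far[OF assms(2)] have "2 ^ q < length c" by simp
  moreover have "finite (snd ` P)" "card (snd ` P) \<le> m"
    using assms(3,4) card_image_le[of P snd] by auto
  ultimately obtain c' where c': "c' \<in> S'" "\<forall>b\<in>snd ` P. 2 ^ q < ldist b c'" "local_game q S S' {(c, c')}"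
    using assms(5-7) unfolding saturated_def by blast
  have "local_game q S S' ({(c, c')} \<union> P)"
  proof (rule local_game_Un_far[OF c'(3) local_game_SucD[OF assms(1)]])
    fix x y a b assume "(x, y) \<in> {(c, c')}" "(a, b) \<in> P"
    moreover from this have "2 ^ q < ldist b c'" using c'(2) by force
    ultimately show "2 ^ q < ldist x a \<and> 2 ^ q < ldist y b"
      using far[of a b] by (simp add: ldist_commute)
  qed
  with c'(1) show ?thesis by auto
qed

primrec quantifier_rank :: "fo_formula \<Rightarrow> nat" where
  "quantifier_rank (Eq s t) = 0"
| "quantifier_rank (Par s t) = 0"
| "quantifier_rank (Neg \<phi>) = quantifier_rank \<phi>"
| "quantifier_rank (Conj \<phi> \<psi>) = max (quantifier_rank \<phi>) (quantifier_rank \<psi>)"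
| "quantifier_rank (Disj \<phi> \<psi>) = max (quantifier_rank \<phi>) (quantifier_rank \<psi>)"
| "quantifier_rank (Impl \<phi> \<psi>) = max (quantifier_rank \<phi>) (quantifier_rank \<psi>)"
| "quantifier_rank (Forall n \<phi>) = Suc (quantifier_rank \<phi>)"
| "quantifier_rank (Exists n \<phi>) = Suc (quantifier_rank \<phi>)"

lemma local_game_0: "local_game q S S' P \<Longrightarrow> local_game 0 S S' P"
  by (induction q) (auto dest: local_game_SucD)

text \<open>The Ehrenfeucht-Fraisse induction: quantifiers demand replies to arbitrary moves, and
  \<open>local_game_extend\<close> supplies them in both directions. The budget
  \<open>card P + q \<le> m\<close> keeps every position within the size that
  \<open>saturated m\<close> can avoid.\<close>

lemma sat_cong_local_game:
  assumes saturated: "saturated m S S'" "saturated m S' S"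
  shows "local_game q S S' P \<Longrightarrow> P \<subseteq> S \<times> S' \<Longrightarrow> ([], []) \<in> P \<Longrightarrow> finite P \<Longrightarrow> card P + q \<le> m \<Longrightarrow>
    quantifier_rank \<phi> \<le> q \<Longrightarrow> (\<And>n. n \<in> free_vars \<phi> \<Longrightarrow> (e n, e' n) \<in> P) \<Longrightarrow>
    sat (addr_tree S) e \<phi> \<longleftrightarrow> sat (addr_tree S') e' \<phi>"
proof (induction \<phi> arbitrary: q P e e')
  case (Eq s t)
  have "(term_val (addr_tree S) e u, term_val (addr_tree S') e' u) \<in> P" if "term_vars u \<subseteq> term_vars s \<union> term_vars t" for u
    using Eq.prems(3,7) that by (cases u) (auto simp: addr_tree_def)
  then have "same_atoms (term_val (addr_tree S) e s) (term_val (addr_tree S) e t) (term_val (addr_tree S') e' s) (term_val (addr_tree S') e' t)"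
    by (intro local_game_0D[OF local_game_0[OF Eq.prems(1)]]) auto
  then show ?case by (simp add: same_atoms_def)
next
  case (Par s t)
  have *: "(term_val (addr_tree S) e u, term_val (addr_tree S') e' u) \<in> P" if "term_vars u \<subseteq> term_vars s \<union> term_vars t" for u
    using Par.prems(3,7) that by (cases u) (auto simp: addr_tree_def)
  then have "same_atoms (term_val (addr_tree S) e s) (term_val (addr_tree S) e t) (term_val (addr_tree S') e' s) (term_val (addr_tree S') e' t)"
    by (intro local_game_0D[OF local_game_0[OF Par.prems(1)]]) auto
  moreover have "term_val (addr_tree S) e s \<in> S" "term_val (addr_tree S) e t \<in> S"
    "term_val (addr_tree S') e' s \<in> S'" "term_val (addr_tree S') e' t \<in> S'"
    using *[of s] *[of t] Par.prems(2) by auto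
  ultimately show ?case by (simp add: same_atoms_def addr_tree_def)
next
  case (Neg \<phi>)
  have "sat (addr_tree S) e \<phi> \<longleftrightarrow> sat (addr_tree S') e' \<phi>"
    by (rule Neg.IH[OF Neg.prems(1-5)]) (use Neg.prems(6,7) in auto)
  then show ?case by simp
next
  case (Conj \<phi> \<psi>)
  from Conj.IH(1)[OF Conj.prems(1-5), of e e'] Conj.IH(2)[OF Conj.prems(1-5), of e e'] Conj.prems(6,7)
  show ?case by simp
next
  case (Disj \<phi> \<psi>)
  from Disj.IH(1)[OF Disj.prems(1-5), of e e'] Disj.IH(2)[OF Disj.prems(1-5), of e e'] Disj.prems(6,7)
  show ?case by simp
next
  case (Impl \<phi> \<psi>)
  from Impl.IH(1)[OF Impl.prems(1-5), of e e'] Impl.IH(2)[OF Impl.prems(1-5), of e e'] Impl.prems(6,7)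
  show ?case by simp
next
  case (Forall n \<phi>)
  then obtain q' where q: "q = Suc q'" by (cases q) auto
  have zig: "\<exists>c'\<in>S'. local_game q' S S' (insert (c, c') P)" if "c \<in> S" for c
    using local_game_extend[OF _ Forall.prems(3,4) _ _ saturated(1) that] Forall.prems(1,5) q by simp
  have zag: "\<exists>c\<in>S. local_game q' S S' (insert (c, c') P)" if "c' \<in> S'" for c'
  proof -
    have "\<exists>c\<in>S. local_game q' S' S (insert (c', c) (P\<inverse>))"
      using local_game_extend[OF _ _ _ _ _ saturated(2) that, of q' "P\<inverse>"] local_game_converse[OF Forall.prems(1)] Forall.prems(3,4,5) q by simp
    then obtain c where c: "c \<in> S" "local_game q' S' S (insert (c', c) (P\<inverse>))" by blast
    have "(insert (c', c) (P\<inverse>))\<inverse> = insert (c, c') P" by auto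
    with c local_game_converse[OF c(2)] show ?thesis by auto
  qed
  have step: "sat (addr_tree S) (e(n := c)) \<phi> \<longleftrightarrow> sat (addr_tree S') (e'(n := c')) \<phi>"
    if "c \<in> S" "c' \<in> S'" "local_game q' S S' (insert (c, c') P)" for c c'
  proof (rule Forall.IH[OF that(3)])
    show "card (insert (c, c') P) + q' \<le> m"
      using card_insert_le_m1[of "Suc (card P)" P "(c, c')"] Forall.prems(5) q by simp
  qed (use Forall.prems that q in auto)
  from zig zag step show ?case unfolding sat.simps by (simp add: addr_tree_def del: fun_upd_apply) blast
next
  case (Exists n \<phi>)
  then obtain q' where q: "q = Suc q'" by (cases q) auto
  have zig: "\<exists>c'\<in>S'. local_game q' S S' (insert (c, c') P)" if "c \<in> S" for c
    using local_game_extend[OF _ Exists.prems(3,4) _ _ saturated(1) that] Exists.prems(1,5) q by simp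
  have zag: "\<exists>c\<in>S. local_game q' S S' (insert (c, c') P)" if "c' \<in> S'" for c'
  proof -
    have "\<exists>c\<in>S. local_game q' S' S (insert (c', c) (P\<inverse>))"
      using local_game_extend[OF _ _ _ _ _ saturated(2) that, of q' "P\<inverse>"] local_game_converse[OF Exists.prems(1)] Exists.prems(3,4,5) q by simp
    then obtain c where c: "c \<in> S" "local_game q' S' S (insert (c', c) (P\<inverse>))" by blast
    have "(insert (c', c) (P\<inverse>))\<inverse> = insert (c, c') P" by auto
    with c local_game_converse[OF c(2)] show ?thesis by auto
  qed
  have step: "sat (addr_tree S) (e(n := c)) \<phi> \<longleftrightarrow> sat (addr_tree S') (e'(n := c')) \<phi>"
    if "c \<in> S" "c' \<in> S'" "local_game q' S S' (insert (c, c') P)" for c c'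
  proof (rule Exists.IH[OF that(3)])
    show "card (insert (c, c') P) + q' \<le> m"
      using card_insert_le_m1[of "Suc (card P)" P "(c, c')"] Exists.prems(5) q by simp
  qed (use Exists.prems that q in auto)
  from zig zag step show ?case unfolding sat.simps by (simp add: addr_tree_def del: fun_upd_apply) blast
qed

datatype plane = Node (kids: "plane list")

primrec addresses :: "plane \<Rightarrow> nat list set" where
  "addresses (Node ts) = insert [] (\<Union>i<length ts. (#) i ` (map addresses ts ! i))"

lemma Nil_in_addresses [simp]: "[] \<in> addresses t"
  by (cases t) simp

lemma Cons_in_addresses [simp]:
  "i # p \<in> addresses (Node ts) \<longleftrightarrow> i < length ts \<and> p \<in> addresses (ts ! i)"
  by auto

declare addresses.simps [simp del]

text \<open>The last clause says that below every vertex any truncation is a finite plane tree: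
  degrees are finite and child indices form initial segments. This is what allows local situations
  to be copied into a finite tree.\<close>

definition plane_tree :: "nat list set \<Rightarrow> bool" where
  "plane_tree S \<longleftrightarrow> [] \<in> S \<and> (\<forall>p q. p @ q \<in> S \<longrightarrow> p \<in> S) \<and>
     (\<forall>a\<in>S. \<forall>h. \<exists>t. addresses t = {p. a @ p \<in> S \<and> length p \<le> h})"

definition occurs :: "plane \<Rightarrow> nat list set \<Rightarrow> bool" where
  "occurs U S \<longleftrightarrow> (\<exists>v. {p. v @ p \<in> S} = addresses U)"

text \<open>Depth \<open>2 ^ q\<close> of \<open>p\<close> is the clearance for playing
  \<open>q\<close> moves inside a copy of \<open>t\<close> without leaving it through its root; the
  copy may therefore hang anywhere in any \<open>S'\<close>.\<close>

definition realizes :: "nat \<Rightarrow> nat list set \<Rightarrow> nat list \<Rightarrow> plane \<Rightarrow> bool" where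
  "realizes q S c t \<longleftrightarrow> (\<exists>p\<in>addresses t. length p = 2 ^ q \<and>
     (\<forall>S' v. {p. v @ p \<in> S'} = addresses t \<longrightarrow> local_game q S S' {(c, v @ p)}))"

text \<open>One representative of each class suffices: its surroundings, cut out as a finite tree,
  serve every vertex of the same class by composition of strategies.\<close>

lemma finitely_many_realizers:
  "\<exists>B. finite B \<and> (\<forall>S c. plane_tree S \<longrightarrow> c \<in> S \<longrightarrow> 2 ^ q < length c \<longrightarrow> (\<exists>t\<in>B. realizes q S c t))"
proof -
  obtain \<tau> :: "nat list set \<times> nat list list \<Rightarrow> nat" where \<tau>0: "finite (range \<tau>)"
    "\<And>S S' a b. length a = 1 \<Longrightarrow> length b = 1 \<Longrightarrow> \<tau> (S, a) = \<tau> (S', b) \<Longrightarrow> local_game q S S' (set (zip a b))"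
    using local_game_finite_index[of 1 q] by blast
  have \<tau>: "finite (range \<tau>)" "\<tau> (S, [c]) = \<tau> (S', [c']) \<Longrightarrow> local_game q S S' {(c, c')}" for S S' c c'
    using \<tau>0(1) \<tau>0(2)[of "[c]" "[c']" S S'] by auto
  have "\<exists>t. \<forall>S c. plane_tree S \<longrightarrow> c \<in> S \<longrightarrow> 2 ^ q < length c \<longrightarrow> \<tau> (S, [c]) = k \<longrightarrow> realizes q S c t" for k
  proof (cases "\<exists>S c. plane_tree S \<and> c \<in> S \<and> 2 ^ q < length c \<and> \<tau> (S, [c]) = k")
    case True
    then obtain S0 c0 where 0: "plane_tree S0" "c0 \<in> S0" "2 ^ q < length c0" "\<tau> (S0, [c0]) = k"
      by blast
    \<comment> \<open>The ancestor \<open>2 ^ q\<close> levels above \<open>c0\<close>, available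
      because \<open>c0\<close> lies deeper than that; it gives the upward clearance.\<close>
    define a where "a = take (length c0 - 2 ^ q) c0"
    define p0 where "p0 = drop (length c0 - 2 ^ q) c0"
    have c0: "c0 = a @ p0" by (simp add: a_def p0_def)
    have len: "length p0 = 2 ^ q" using 0 by (simp add: p0_def)
    have "a \<in> S0" using 0 c0 unfolding plane_tree_def by metis
    \<comment> \<open>Depth \<open>2 * 2 ^ q\<close> below \<open>a\<close> leaves the downward
      clearance \<open>2 ^ q\<close> below \<open>c0\<close>.\<close>
    then obtain t where t: "addresses t = {p. a @ p \<in> S0 \<and> length p \<le> 2 * 2 ^ q}"
      using 0 unfolding plane_tree_def by metis
    have "realizes q S c t" if "\<tau> (S, [c]) = k" for S c
      unfolding realizes_def
    proof (intro bexI[of _ p0] conjI allI impI)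
      show "p0 \<in> addresses t" using t c0 0 len by simp
      show "length p0 = 2 ^ q" by (rule len)
      fix S' v assume S': "{p. v @ p \<in> S'} = addresses t"
      have "local_game q S0 S' {(c0, v @ p0)}"
      proof (rule local_game_copy[where a = a and v = v and H = "2 * 2 ^ q"])
        fix p :: "nat list" assume "length p \<le> 2 * 2 ^ q"
        then show "a @ p \<in> S0 \<longleftrightarrow> v @ p \<in> S'" using S' t by blast
      qed (use c0 len in auto)
      moreover have "local_game q S S0 {(c, c0)}" using \<tau>(2) that 0 by simp
      ultimately have "local_game q S S' ({(c, c0)} O {(c0, v @ p0)})" by (rule local_game_trans[rotated])
      then show "local_game q S S' {(c, v @ p0)}" by (rule local_game_mono) auto
    qed
    then show ?thesis by blast
  qed blast
  then obtain T where T: "\<And>S c. plane_tree S \<Longrightarrow> c \<in> S \<Longrightarrow> 2 ^ q < length c \<Longrightarrow> realizes q S c (T (\<tau> (S, [c])))"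
    by metis
  show ?thesis using T \<tau>(1) by (intro exI[of _ "T ` range \<tau>"]) auto
qed

lemma length_filter_concat_replicate:
  "length (filter P (concat (replicate n xs))) = n * length (filter P xs)"
  by (induction n) auto

text \<open>
  The root of the universal tree gets so many copies of each local situation that, whatever
  vertices have been chosen, one of the copies is far from all of them.
\<close>

lemma universal_tree:
  "\<exists>U. \<forall>S S'. plane_tree S \<longrightarrow> occurs U S' \<longrightarrow> saturated m S S'"
proof -
  obtain B where B: "\<And>q. finite (B q)"
    "\<And>q S c. plane_tree S \<Longrightarrow> c \<in> S \<Longrightarrow> 2 ^ q < length c \<Longrightarrow> \<exists>t\<in>B q. realizes q S c t"
    using finitely_many_realizers by metis
  have "finite (\<Union>q<m. B q)" using B by blast
  then obtain bs where bs: "set bs = (\<Union>q<m. B q)" using finite_list by blast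
  define ts where "ts = concat (replicate (Suc m) bs)"
  have "saturated m S S'" if S: "plane_tree S" and occ: "occurs (Node ts) S'" for S S'
    unfolding saturated_def
  proof (intro allI ballI impI, elim conjE)
    fix q c and X :: "nat list set" assume q: "q < m" and c: "c \<in> S" "2 ^ q < length c" and X: "finite X" "card X \<le> m"
    obtain t where t: "t \<in> B q" "realizes q S c t" using B(2)[OF S c] by blast
    then obtain p where p: "p \<in> addresses t" "length p = 2 ^ q"
      "\<And>S' v. {p. v @ p \<in> S'} = addresses t \<Longrightarrow> local_game q S S' {(c, v @ p)}"
      unfolding realizes_def by blast
    obtain v where v: "{p. v @ p \<in> S'} = addresses (Node ts)" using occ unfolding occurs_def by blast
    define J where "J = {j. j < length ts \<and> ts ! j = t}"
    have "t \<in> set bs" using bs t q by blast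
    then have "length (filter (\<lambda>u. u = t) bs) > 0" by (auto simp: filter_empty_conv)
    moreover have "card J = Suc m * length (filter (\<lambda>u. u = t) bs)"
      unfolding J_def ts_def using length_filter_concat_replicate[of "\<lambda>u. u = t" "Suc m" bs]
      by (simp add: length_filter_conv_card del: replicate.simps)
    ultimately have "m < card J" by (cases "length (filter (\<lambda>u. u = t) bs)") auto
    have "\<exists>j\<in>J. \<forall>x\<in>X. 2 ^ q < ldist x ((v @ [j]) @ p)"
    proof (rule ccontr)
      assume "\<not> ?thesis"
      then have near: "\<exists>x\<in>X. ldist x ((v @ [j]) @ p) \<le> 2 ^ q" if "j \<in> J" for j
        using that by (meson not_le)
      \<comment> \<open>As \<open>p\<close> has depth \<open>2 ^ q\<close> in its copy of
        \<open>t\<close>, a vertex within \<open>2 ^ q\<close> of it lies in the same copy and shows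
        the index \<open>j\<close> at position \<open>length v\<close>. Each chosen vertex thus
        spoils at most one copy.\<close>
      have "J \<subseteq> (\<lambda>x. x ! length v) ` X"
      proof
        fix j assume "j \<in> J"
        then obtain x where x: "x \<in> X" "ldist ((v @ [j]) @ p) x \<le> length p"
          using near p(2) by (metis ldist_commute)
        from ldist_append_le_length[OF x(2)] show "j \<in> (\<lambda>x. x ! length v) ` X"
          using x(1) by (force simp: nth_append)
      qed
      then have "card J \<le> card X" using X by (meson card_image_le card_mono finite_imageI le_trans)
      with X \<open>m < card J\<close> show False by simp
    qed
    then obtain j where j: "j \<in> J" "\<forall>x\<in>X. 2 ^ q < ldist x ((v @ [j]) @ p)" by blast
    have v': "{p. (v @ [j]) @ p \<in> S'} = addresses t"
    proof -
      have "(v @ [j]) @ p \<in> S' \<longleftrightarrow> p \<in> addresses t" for p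
      proof -
        have "v @ (j # p) \<in> S' \<longleftrightarrow> j # p \<in> addresses (Node ts)" using v by blast
        then show ?thesis using j(1) by (simp add: J_def)
      qed
      then show ?thesis by blast
    qed
    then have "(v @ [j]) @ p \<in> S'" using p(1) by blast
    with j(2) p(3)[OF v'] show "\<exists>c'\<in>S'. (\<forall>b\<in>X. 2 ^ q < ldist b c') \<and> local_game q S S' {(c, c')}"
      by blast
  qed
  then show ?thesis by blast
qed

theorem sat_determined_near_root:
  assumes "sentence \<phi>"
  obtains U r where "\<And>S S' e e'. plane_tree S \<Longrightarrow> plane_tree S' \<Longrightarrow> occurs U S \<Longrightarrow> occurs U S' \<Longrightarrow>
    (\<And>p. length p \<le> r \<Longrightarrow> p \<in> S \<longleftrightarrow> p \<in> S') \<Longrightarrow> sat (addr_tree S) e \<phi> \<longleftrightarrow> sat (addr_tree S') e' \<phi>"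
proof -
  let ?q = "quantifier_rank \<phi>"
  obtain U where U: "\<And>S S'. plane_tree S \<Longrightarrow> occurs U S' \<Longrightarrow> saturated (Suc ?q) S S'"
    using universal_tree by blast
  \<comment> \<open>\<open>2 ^ ?q\<close> is the clearance about the root for \<open>?q\<close>
    moves; the parameter \<open>Suc ?q\<close> allows for the initial pair of roots and one more
    pair per quantifier.\<close>
  show thesis
  proof (rule that[of U "2 ^ ?q"])
    fix S S' e e' assume *: "plane_tree S" "plane_tree S'" "occurs U S" "occurs U S'"
      and near: "\<And>p. length p \<le> 2 ^ ?q \<Longrightarrow> p \<in> S \<longleftrightarrow> p \<in> S'"
    show "sat (addr_tree S) e \<phi> \<longleftrightarrow> sat (addr_tree S') e' \<phi>"
    proof (rule sat_cong_local_game)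
      show "saturated (Suc ?q) S S'" "saturated (Suc ?q) S' S" using U * by blast+
      show "local_game ?q S S' {([], [])}"
        by (rule local_game_copy[where a = "[]" and v = "[]" and H = "2 ^ ?q"]) (use near in auto)
      show "{([], [])} \<subseteq> S \<times> S'" using * by (simp add: plane_tree_def)
    qed (use assms in \<open>auto simp: sentence_def\<close>)
  qed
qed


subsection \<open>The Galton-Watson tree as a plane tree\<close>

definition first_child :: "(nat \<Rightarrow> nat) \<Rightarrow> nat \<Rightarrow> nat" where
  "first_child x i = 2 + (\<Sum>k = 1..<i. x k)"

lemma first_child_Suc: "1 \<le> i \<Longrightarrow> first_child x (Suc i) = first_child x i + x i"
  by (simp add: first_child_def)

lemma bfs_child_iff: "1 \<le> i \<Longrightarrow> bfs_child x i j \<longleftrightarrow> first_child x i \<le> j \<and> j < first_child x i + x i"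
proof -
  assume "1 \<le> i"
  then have "{1..i} = insert i {1..<i}" by auto
  then have "(\<Sum>k = 1..i. x k) = x i + (\<Sum>k = 1..<i. x k)" by simp
  then show ?thesis unfolding bfs_child_def first_child_def by linarith
qed

fun node_at :: "(nat \<Rightarrow> nat) \<Rightarrow> nat \<Rightarrow> nat list \<Rightarrow> nat" where
  "node_at x i [] = i"
| "node_at x i (j # p) = node_at x (first_child x i + j) p"

fun is_address :: "(nat \<Rightarrow> nat) \<Rightarrow> nat \<Rightarrow> nat list \<Rightarrow> bool" where
  "is_address x i [] \<longleftrightarrow> True"
| "is_address x i (j # p) \<longleftrightarrow> j < x i \<and> is_address x (first_child x i + j) p"

text \<open>Nodes at relative depth \<open>h\<close> are shown childless whatever their offspring
  number. The label \<open>i\<close> is arbitrary and need not belong to the tree.\<close>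

primrec gw_trunc :: "(nat \<Rightarrow> nat) \<Rightarrow> nat \<Rightarrow> nat \<Rightarrow> plane" where
  "gw_trunc x 0 i = Node []"
| "gw_trunc x (Suc h) i = Node (map (gw_trunc x h) [first_child x i..<first_child x i + x i])"

lemma node_at_append: "node_at x i (p @ q) = node_at x (node_at x i p) q"
  by (induction p arbitrary: i) auto

lemma is_address_append: "is_address x i (p @ q) \<longleftrightarrow> is_address x i p \<and> is_address x (node_at x i p) q"
  by (induction p arbitrary: i) auto

lemma addresses_gw_trunc: "addresses (gw_trunc x h i) = {p. is_address x i p \<and> length p \<le> h}"
proof -
  have "p \<in> addresses (gw_trunc x h i) \<longleftrightarrow> is_address x i p \<and> length p \<le> h" for p
  proof (induction h arbitrary: i p)
    case 0
    show ?case by (cases p) simp_all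
  next
    case (Suc h)
    show ?case
    proof (cases p)
      case (Cons j q)
      show ?thesis
      proof (cases "j < x i")
        case True
        then show ?thesis using Suc[of q "first_child x i + j"] Cons by simp
      qed (simp add: Cons)
    qed simp
  qed
  then show ?thesis by blast
qed

lemma plane_tree_is_address: "plane_tree {p. is_address x i p}"
  unfolding plane_tree_def
proof (intro conjI ballI allI impI)
  fix a h assume "a \<in> {p. is_address x i p}"
  then show "\<exists>t. addresses t = {p. a @ p \<in> {p. is_address x i p} \<and> length p \<le> h}"
    by (intro exI[of _ "gw_trunc x h (node_at x i a)"]) (simp add: addresses_gw_trunc is_address_append)
qed (auto simp: is_address_append)

lemma node_at_in_bfs_nodes: "is_address x 1 p \<Longrightarrow> node_at x 1 p \<in> bfs_nodes x"
proof (induction p rule: rev_induct)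
  case Nil
  show ?case using bfs_nodes.root[of x] by simp
next
  case (snoc k p)
  let ?i = "node_at x 1 p"
  have "is_address x 1 p" "k < x ?i" using snoc.prems unfolding is_address_append by simp_all
  then have i: "?i \<in> bfs_nodes x" using snoc.IH by blast
  then have "1 \<le> ?i" using bfs_nodes_bound[of ?i x] by blast
  then have "bfs_child x ?i (first_child x ?i + k)" using \<open>k < x ?i\<close> by (simp only: bfs_child_iff) simp
  from bfs_nodes.child[OF i this] show ?case by (simp only: node_at_append node_at.simps)
qed

lemma bfs_child_node_atE:
  assumes "is_address x 1 p" "bfs_child x (node_at x 1 p) j"
  obtains k where "is_address x 1 (p @ [k])" "j = node_at x 1 (p @ [k])"
proof (rule that)
  let ?i = "node_at x 1 p"
  have "1 \<le> ?i" using bfs_nodes_bound[OF node_at_in_bfs_nodes[OF assms(1)]] by blast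
  then have "first_child x ?i \<le> j" "j < first_child x ?i + x ?i"
    using assms(2) by (simp_all add: bfs_child_iff)
  then show "is_address x 1 (p @ [j - first_child x ?i])" "j = node_at x 1 (p @ [j - first_child x ?i])"
    using assms(1) by (simp_all add: is_address_append node_at_append less_diff_conv2)
qed

lemma bfs_child_node_at:
  assumes "is_address x 1 (p @ [k])"
  shows "bfs_child x (node_at x 1 p) (node_at x 1 (p @ [k]))"
proof -
  have "1 \<le> node_at x 1 p"
    using assms bfs_nodes_bound[OF node_at_in_bfs_nodes, of x p] by (simp add: is_address_append)
  then show ?thesis using assms by (simp add: bfs_child_iff is_address_append node_at_append)
qed

text \<open>Addresses are recovered from their end: the root is nobody's child, uniqueness of the
  parent identifies all but the last index, and the offset among the siblings gives the last
  one.\<close>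

lemma inj_on_node_at: "inj_on (node_at x 1) {p. is_address x 1 p}"
proof -
  have root: "node_at x 1 (p @ [k]) \<noteq> node_at x 1 []" for p k
    by (simp add: node_at_append first_child_def)
  have "is_address x 1 p \<Longrightarrow> is_address x 1 q \<Longrightarrow> node_at x 1 p = node_at x 1 q \<Longrightarrow> p = q" for p q
  proof (induction p arbitrary: q rule: rev_induct)
    case Nil
    show ?case
    proof (cases q rule: rev_exhaust)
      case q: (snoc q' l)
      then show ?thesis using Nil(3) root[of q' l] by metis
    qed simp
  next
    case (snoc k p)
    show ?case
    proof (cases q rule: rev_exhaust)
      case Nil
      then show ?thesis using snoc.prems(3) root[of p k] by metis
    next
      case q: (snoc q' l)
      have "bfs_child x (node_at x 1 q') (node_at x 1 (p @ [k]))"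
        using bfs_child_node_at[of x q' l] snoc.prems(2,3) unfolding q by simp
      then have *: "node_at x 1 p = node_at x 1 q'"
        using bfs_child_unique[OF bfs_child_node_at[OF snoc.prems(1)]] by blast
      moreover have "k = l" using snoc.prems(3) * unfolding q by (simp add: node_at_append)
      moreover have "p = q'"
        using snoc.IH[OF _ _ *] snoc.prems(1,2) unfolding q by (simp add: is_address_append)
      ultimately show ?thesis using q by simp
    qed
  qed
  then show ?thesis by (auto intro!: inj_onI)
qed

lemma node_at_image: "node_at x 1 ` {p. is_address x 1 p} = bfs_nodes x"
proof
  show "bfs_nodes x \<subseteq> node_at x 1 ` {p. is_address x 1 p}"
  proof
    fix j assume "j \<in> bfs_nodes x"
    then show "j \<in> node_at x 1 ` {p. is_address x 1 p}"
    proof (induction rule: bfs_nodes.induct)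
      case root
      then show ?case by (intro image_eqI[of _ _ "[]"]) auto
    next
      case (child i j)
      then obtain p where p: "is_address x 1 p" "i = node_at x 1 p" by blast
      then obtain k where "is_address x 1 (p @ [k])" "j = node_at x 1 (p @ [k])"
        using bfs_child_node_atE child.hyps by metis
      then show ?case by blast
    qed
  qed
qed (use node_at_in_bfs_nodes in auto)

lemma sat_bfs_tree_iff:
  "sat (bfs_tree x) (\<lambda>_. 1) \<phi> \<longleftrightarrow> sat (addr_tree {p. is_address x 1 p}) (\<lambda>_. []) \<phi>"
proof -
  have "sat (bfs_tree x) (\<lambda>n. node_at x 1 ((\<lambda>_. []) n)) \<phi> \<longleftrightarrow> sat (addr_tree {p. is_address x 1 p}) (\<lambda>_. []) \<phi>"
  proof (rule sat_isomorphic[of "node_at x 1"])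
    show "bij_betw (node_at x 1) (verts (addr_tree {p. is_address x 1 p})) (verts (bfs_tree x))"
      using inj_on_node_at node_at_image by (simp add: bij_betw_def addr_tree_def bfs_tree_def)
  next
    fix u v assume uv: "u \<in> verts (addr_tree {p. is_address x 1 p})" "v \<in> verts (addr_tree {p. is_address x 1 p})"
    then have uv: "is_address x 1 u" "is_address x 1 v" by (auto simp: addr_tree_def)
    have "bfs_child x (node_at x 1 v) (node_at x 1 u) \<longleftrightarrow> (\<exists>k. u = v @ [k])"
    proof
      assume "bfs_child x (node_at x 1 v) (node_at x 1 u)"
      then obtain k where "is_address x 1 (v @ [k])" "node_at x 1 u = node_at x 1 (v @ [k])"
        using bfs_child_node_atE[OF uv(2)] by metis
      then show "\<exists>k. u = v @ [k]" using inj_onD[OF inj_on_node_at, of x u "v @ [k]"] uv by blast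
    qed (use uv bfs_child_node_at in blast)
    then show "(node_at x 1 u, node_at x 1 v) \<in> parent (bfs_tree x) \<longleftrightarrow> (u, v) \<in> parent (addr_tree {p. is_address x 1 p})"
      using uv node_at_in_bfs_nodes by (auto simp: bfs_tree_def addr_tree_def)
  qed (auto simp: addr_tree_def bfs_tree_def)
  then show ?thesis by simp
qed

section \<open>The law of the truncated tree\<close>

primrec trunc_trees :: "nat \<Rightarrow> plane set" where
  "trunc_trees 0 = {Node []}"
| "trunc_trees (Suc h) = Node ` lists (trunc_trees h)"

lemma gw_trunc_in_trunc_trees [simp]: "gw_trunc x h i \<in> trunc_trees h"
  by (induction h arbitrary: i) (auto simp: in_lists_conv_set intro!: imageI)

text \<open>\<open>ts\<close> is one level of the tree, given by the subtrees hanging there. The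
  offspring numbers are listed in breadth first order for \<open>h\<close> levels; the leaves
  produced by truncation say nothing about offspring.\<close>

primrec bfs_code :: "nat \<Rightarrow> plane list \<Rightarrow> nat list" where
  "bfs_code 0 ts = []"
| "bfs_code (Suc h) ts = map (\<lambda>t. length (kids t)) ts @ bfs_code h (concat (map kids ts))"

lemma concat_children:
  "1 \<le> L \<Longrightarrow> concat (map (\<lambda>i. map f [first_child x i..<first_child x i + x i]) [L..<L + n]) =
     map f [first_child x L..<first_child x (L + n)]"
proof (induction n)
  case (Suc n)
  have "mono (first_child x)" by (auto simp: first_child_def mono_def intro!: sum_mono2)
  then have "first_child x L \<le> first_child x (L + n)" by (rule monoD) simp
  then have "[first_child x L..<first_child x (L + n) + x (L + n)] =
     [first_child x L..<first_child x (L + n)] @ [first_child x (L + n)..<first_child x (L + n) + x (L + n)]"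
    by (rule upt_add_eq_append)
  with Suc first_child_Suc[of "L + n" x] show ?case by simp
qed simp

lemma map_upt_append_eq_iff:
  "map f [L..<L + length (as @ bs)] = as @ bs \<longleftrightarrow>
     map f [L..<L + length as] = as \<and> map f [L + length as..<L + length as + length bs] = bs"
proof -
  have "[L..<L + length (as @ bs)] = [L..<L + length as] @ [L + length as..<L + length as + length bs]"
    using upt_add_eq_append[of L "L + length as" "length bs"] by (simp add: add.assoc)
  then show ?thesis by (simp add: append_eq_append_conv)
qed

text \<open>The induction treats whole levels, because labels of a level are consecutive whereas
  those of a single subtree are not. The hypothesis on \<open>first_child x L\<close> says that the
  children of this block of nodes start right after it.\<close>

lemma map_gw_trunc_eq_iff:
  assumes "1 \<le> L" "first_child x L = L + length ts" "ts \<in> lists (trunc_trees h)"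
  shows "map (gw_trunc x h) [L..<L + length ts] = ts \<longleftrightarrow>
    map x [L..<L + length (bfs_code h ts)] = bfs_code h ts"
  using assms
proof (induction h arbitrary: L ts)
  case 0
  then have "\<forall>t\<in>set ts. t = Node []" by auto
  then have "replicate (length ts) (Node []) = ts" by (rule replicate_length_same)
  moreover have "map (gw_trunc x 0) [L..<L + length ts] = replicate (length ts) (Node [])"
    by (rule nth_equalityI) auto
  ultimately have "map (gw_trunc x 0) [L..<L + length ts] = ts" by argo
  then show ?case by (simp del: gw_trunc.simps)
next
  case (Suc h)
  define L' where "L' = L + length ts"
  define us where "us = concat (map kids ts)"
  let ?as = "map (\<lambda>t. length (kids t)) ts"
  have "set (kids t) \<subseteq> trunc_trees h" if "t \<in> set ts" for t
  proof -
    have "t \<in> Node ` lists (trunc_trees h)" using Suc.prems(3) that by auto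
    then show ?thesis by auto
  qed
  then have us: "us \<in> lists (trunc_trees h)" unfolding us_def by (auto simp: subset_iff)
  have *: "map (gw_trunc x (Suc h)) [L..<L'] = ts \<longleftrightarrow>
    map x [L..<L'] = ?as \<and> map (gw_trunc x h) [L'..<first_child x L'] = us" (is "?l \<longleftrightarrow> ?r1 \<and> ?r2")
  proof -
    have inj: "inj kids" by (rule injI) (rule plane.expand)
    have "?l \<longleftrightarrow> map kids (map (gw_trunc x (Suc h)) [L..<L']) = map kids ts"
      unfolding inj_map_eq_map[OF inj] ..
    also have "map kids (map (gw_trunc x (Suc h)) [L..<L']) =
      map (\<lambda>i. map (gw_trunc x h) [first_child x i..<first_child x i + x i]) [L..<L']" (is "_ = ?A") by simp
    finally have 1: "?l \<longleftrightarrow> ?A = map kids ts" .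
    have 2: "map length ?A = map x [L..<L']" by simp
    have 3: "map length (map kids ts) = ?as" by simp
    have 4: "concat ?A = map (gw_trunc x h) [L'..<first_child x L']"
      using concat_children[OF Suc.prems(1), of "gw_trunc x h" x "length ts"] Suc.prems(2) by (simp add: L'_def)
    \<comment> \<open>A concatenation splits uniquely once the block lengths are known, so comparing
      the next level as a whole replaces comparing families of siblings.\<close>
    have 5: "?A = map kids ts \<longleftrightarrow> concat ?A = us" if ?r1
      unfolding us_def
    proof (rule concat_eq_concat_iff[symmetric])
      show "length ?A = length (map kids ts)" by (simp add: L'_def)
      have "x (L + i) = length (kids (ts ! i))" if "i < length ts" for i
        using arg_cong[OF \<open>?r1\<close>, of "\<lambda>l. l ! i"] that by (simp add: L'_def)
      then show "\<forall>(u, v)\<in>set (zip ?A (map kids ts)). length u = length v"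
        unfolding set_zip by (auto simp: L'_def)
    qed
    have 6: ?r1 if "?A = map kids ts"
      using arg_cong[OF that, of "map length"] unfolding 2 3 .
    show ?thesis unfolding 1 4[symmetric] using 5 6 by blast
  qed
  \<comment> \<open>The next level satisfies the hypothesis on \<open>first_child\<close> again,
    since the offspring numbers of this level add up to the length of \<open>us\<close>.\<close>
  have fc: "first_child x L' = L' + length us" if "map x [L..<L'] = ?as"
  proof -
    have "first_child x (L + n) = first_child x L + sum_list (map x [L..<L + n])" for n
      using Suc.prems(1) by (induction n) (simp_all add: first_child_Suc)
    then show ?thesis using that Suc.prems(2) by (simp add: L'_def us_def length_concat comp_def)
  qed
  have "map (gw_trunc x (Suc h)) [L..<L'] = ts \<longleftrightarrow>
    map x [L..<L'] = ?as \<and> map x [L'..<L' + length (bfs_code h us)] = bfs_code h us"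
  proof (cases "map x [L..<L'] = ?as")
    case True
    have "1 \<le> L'" using Suc.prems(1) by (simp add: L'_def)
    from Suc.IH[OF this fc[OF True] us] show ?thesis using True unfolding * fc[OF True] by blast
  next
    case False
    then show ?thesis unfolding * by blast
  qed
  then show ?case
    using map_upt_append_eq_iff[of x L ?as "bfs_code h us"]
    by (simp add: L'_def us_def del: gw_trunc.simps)
qed

lemma gw_trunc_eq_iff:
  assumes "t \<in> trunc_trees h"
  shows "gw_trunc x h 1 = t \<longleftrightarrow> map x [1..<1 + length (bfs_code h [t])] = bfs_code h [t]"
  using map_gw_trunc_eq_iff[of 1 x "[t]" h] assms by (simp add: first_child_def)

text \<open>A product over the nodes of depth below \<open>h\<close>. Depending on \<open>f\<close>
  it is the probability of a truncated tree, its continuation to complex rates, or a real majorant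
  of the latter; this is why the codomain is left general.\<close>

primrec weight :: "(nat \<Rightarrow> 'a::comm_monoid_mult) \<Rightarrow> nat \<Rightarrow> plane \<Rightarrow> 'a" where
  "weight f 0 = (\<lambda>t. 1)"
| "weight f (Suc h) = (\<lambda>t. f (length (kids t)) * prod_list (map (weight f h) (kids t)))"

lemma prod_list_map_mult:
  "prod_list (map (\<lambda>t. f t * g t) ts) = prod_list (map f ts) * (prod_list (map g ts) :: 'a::comm_monoid_mult)"
  by (induction ts) (auto simp: ac_simps)

lemma prod_list_bfs_code: "prod_list (map f (bfs_code h ts)) = prod_list (map (weight f h) ts)"
proof (induction h arbitrary: ts)
  case 0
  show ?case by (induction ts) auto
next
  case (Suc h)
  have "prod_list (map (weight f h) (concat (map kids ts))) = prod_list (map (\<lambda>t. prod_list (map (weight f h) (kids t))) ts)"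
    by (induction ts) auto
  with Suc show ?case by (simp add: prod_list_map_mult comp_def)
qed

lemma prob_space_poisson_law: "prob_space (poisson_law lam)"
  unfolding poisson_law_def by (intro prob_space_PiM prob_space_measure_pmf)

lemma measure_poisson_law_cylinder:
  "{x \<in> space (poisson_law lam). map x [1..<1 + length c] = c} \<in> sets (poisson_law lam)" (is ?th1)
  "measure (poisson_law lam) {x \<in> space (poisson_law lam). map x [1..<1 + length c] = c} =
    prod_list (map (pmf (poisson_pmf lam)) c)" (is ?th2)
proof -
  interpret product_prob_space "\<lambda>_. measure_pmf (poisson_pmf lam)" "{1::nat..}"
    by (intro product_prob_spaceI prob_space_measure_pmf)
  have eq: "{x \<in> space (poisson_law lam). map x [1..<1 + length c] = c} =
      {x \<in> space (poisson_law lam). \<forall>i\<in>{1..<1 + length c}. x i \<in> {c ! (i - 1)}}"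
    (is "?X = ?Y")
  proof -
    have "map x [1..<1 + length c] = c \<longleftrightarrow> (\<forall>j<length c. x (Suc j) = c ! j)" for x
      unfolding list_eq_iff_nth_eq by (simp del: upt_Suc)
    moreover have "(\<forall>i\<in>{1..<1 + length c}. x i = c ! (i - 1)) \<longleftrightarrow> (\<forall>j<length c. x (Suc j) = c ! j)" for x
    proof -
      have "{1..<1 + length c} = Suc ` {..<length c}" by (simp add: lessThan_atLeast0)
      then have "(\<forall>i\<in>{1..<1 + length c}. x i = c ! (i - 1)) \<longleftrightarrow> (\<forall>j\<in>{..<length c}. x (Suc j) = c ! j)"
        by (metis (no_types, lifting) diff_Suc_1 image_iff)
      then show ?thesis unfolding Ball_def lessThan_iff .
    qed
    ultimately show ?thesis by simp
  qed
  have Y: "?Y = prod_emb {1..} (\<lambda>_. measure_pmf (poisson_pmf lam)) {1..<1 + length c}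
      (Pi\<^sub>E {1..<1 + length c} (\<lambda>i. {c ! (i - 1)}))"
    unfolding prod_emb_def poisson_law_def by (auto simp: space_PiM PiE_iff extensional_def)
  show ?th1 unfolding eq Y unfolding poisson_law_def by (rule sets_PiM_I) auto
  have "measure (poisson_law lam) ?Y = (\<Prod>i\<in>{1..<1 + length c}. pmf (poisson_pmf lam) (c ! (i - 1)))"
    unfolding Y unfolding poisson_law_def by (subst measure_PiM_emb) (auto simp: measure_pmf_single)
  also have "\<dots> = (\<Prod>i\<in>{0..<length c}. pmf (poisson_pmf lam) (c ! i))"
    by (rule prod.reindex_bij_witness[of _ Suc "\<lambda>i. i - 1"]) auto
  also have "\<dots> = prod_list (map (pmf (poisson_pmf lam)) c)"
    by (simp add: prod.list_conv_set_nth)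
  finally show ?th2 using eq by simp
qed

definition gw_event :: "real \<Rightarrow> nat \<Rightarrow> plane \<Rightarrow> (nat \<Rightarrow> nat) set" where
  "gw_event lam h t = {x \<in> space (poisson_law lam). gw_trunc x h 1 = t}"

lemma measure_gw_event:
  assumes "t \<in> trunc_trees h"
  shows "gw_event lam h t \<in> sets (poisson_law lam)"
    and "measure (poisson_law lam) (gw_event lam h t) = weight (pmf (poisson_pmf lam)) h t"
  using measure_poisson_law_cylinder[of lam "bfs_code h [t]"] prod_list_bfs_code[of _ h "[t]"]
  unfolding gw_event_def gw_trunc_eq_iff[OF assms] by simp_all


instance plane :: countable
  by countable_datatype

subsection \<open>Trees avoiding a given tree\<close>

text \<open>All nodes have depth below \<open>h\<close>, so every leaf of a tree truncated at
  \<open>h\<close> is a true leaf and the tree has been seen completely.\<close>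

primrec fully_grown :: "nat \<Rightarrow> plane \<Rightarrow> bool" where
  "fully_grown 0 = (\<lambda>t. False)"
| "fully_grown (Suc h) = (\<lambda>t. \<forall>u\<in>set (kids t). fully_grown h u)"

lemma fully_grown_mono: "fully_grown h t \<Longrightarrow> h \<le> h' \<Longrightarrow> fully_grown h' t"
proof (induction h arbitrary: h' t)
  case (Suc h)
  from Suc.prems(2) obtain k where k: "h' = Suc k" "h \<le> k" by (cases h') auto
  have "fully_grown k u" if "u \<in> set (kids t)" for u
    by (rule Suc.IH[OF _ k(2)]) (use Suc.prems(1) that in simp)
  with k show ?case by simp
qed simp

lemma fully_grown_exists: "\<exists>h. fully_grown h t"
proof (induction t)
  case (Node ts)
  then obtain H where H: "\<And>u. u \<in> set ts \<Longrightarrow> fully_grown (H u) u" by metis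
  have "fully_grown (Max (H ` set ts)) u" if "u \<in> set ts" for u
    by (rule fully_grown_mono[OF H[OF that]]) (use that in auto)
  then have "fully_grown (Suc (Max (H ` set ts))) (Node ts)" by simp
  then show ?case by blast
qed

lemma fully_grown_imp_trunc_trees: "fully_grown h t \<Longrightarrow> t \<in> trunc_trees h"
proof (induction h arbitrary: t)
  case (Suc h)
  then have "kids t \<in> lists (trunc_trees h)" by (simp add: in_lists_conv_set)
  from imageI[OF this, of Node] show ?case by simp
qed simp

lemma fully_grown_gw_trunc:
  "fully_grown h (gw_trunc x h i) \<Longrightarrow> h \<le> h' \<Longrightarrow> gw_trunc x h' i = gw_trunc x h i"
proof (induction h arbitrary: h' i)
  case (Suc h)
  from Suc.prems(2) obtain k where k: "h' = Suc k" "h \<le> k" by (cases h') auto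
  have "gw_trunc x k j = gw_trunc x h j" if "j \<in> set [first_child x i..<first_child x i + x i]" for j
    by (rule Suc.IH[OF _ k(2)]) (use Suc.prems(1) that in simp)
  then have "map (gw_trunc x k) [first_child x i..<first_child x i + x i] =
      map (gw_trunc x h) [first_child x i..<first_child x i + x i]" by (rule map_cong[OF refl])
  with k show ?case by (simp only: gw_trunc.simps)
qed simp

lemma weight_fully_grown: "fully_grown h t \<Longrightarrow> h \<le> h' \<Longrightarrow> weight f h' t = weight f h t"
proof (induction h arbitrary: h' t)
  case (Suc h)
  from Suc.prems(2) obtain k where k: "h' = Suc k" "h \<le> k" by (cases h') auto
  have "weight f k u = weight f h u" if "u \<in> set (kids t)" for u
    by (rule Suc.IH[OF _ k(2)]) (use Suc.prems(1) that in simp)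
  then have "map (weight f k) (kids t) = map (weight f h) (kids t)" by (rule map_cong[OF refl])
  with k show ?case by (simp only: weight.simps)
qed simp

lemma prod_list_nonneg_mono:
  fixes f g :: "'b \<Rightarrow> real"
  assumes "\<And>t. t \<in> set ts \<Longrightarrow> 0 \<le> f t \<and> f t \<le> g t"
  shows "0 \<le> prod_list (map f ts) \<and> prod_list (map f ts) \<le> prod_list (map g ts)"
  using assms
proof (induction ts)
  case (Cons t ts)
  have "0 \<le> f t \<and> f t \<le> g t" "0 \<le> prod_list (map f ts) \<and> prod_list (map f ts) \<le> prod_list (map g ts)"
    using Cons by auto
  then show ?case by (simp add: mult_mono)
qed simp

lemma weight_nonneg_mono:
  fixes f g :: "nat \<Rightarrow> real"
  assumes "\<And>n. 0 \<le> f n \<and> f n \<le> g n"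
  shows "0 \<le> weight f h t \<and> weight f h t \<le> weight g h t"
proof (induction h arbitrary: t)
  case (Suc h)
  have "0 \<le> prod_list (map (weight f h) (kids t)) \<and>
    prod_list (map (weight f h) (kids t)) \<le> prod_list (map (weight g h) (kids t))"
    by (rule prod_list_nonneg_mono) (rule Suc)
  then show ?case using assms[of "length (kids t)"] by (simp add: mult_mono)
qed simp

lemma weight_pos:
  fixes f :: "nat \<Rightarrow> real"
  assumes "\<And>n. 0 < f n"
  shows "0 < weight f h t"
proof (induction h arbitrary: t)
  case (Suc h)
  have "0 < prod_list (map (weight f h) ts)" for ts
    by (induction ts) (use Suc in auto)
  then show ?case using assms by simp
qed simp

lemma norm_weight_le:
  fixes f :: "nat \<Rightarrow> complex"
  assumes "\<And>n. norm (f n) \<le> g n"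
  shows "norm (weight f h t) \<le> weight g h t"
proof (induction h arbitrary: t)
  case (Suc h)
  have mono: "norm (a * b) \<le> c * d" if "norm a \<le> c" "norm b \<le> d" for a b :: complex and c d
    using mult_mono[OF that order_trans[OF norm_ge_zero that(1)]] by (simp add: norm_mult)
  have "norm (prod_list (map (weight f h) ts)) \<le> prod_list (map (weight g h) ts)" for ts
  proof (induction ts)
    case (Cons u ts)
    from mono[OF Suc[of u] Cons] show ?case by simp
  qed simp
  from mono[OF assms this] show ?case by simp
qed simp

lemma weight_of_real: "weight (\<lambda>n. complex_of_real (f n)) h t = of_real (weight f h t)"
proof (induction h arbitrary: t)
  case (Suc h)
  have "prod_list (map (weight (\<lambda>n. complex_of_real (f n)) h) ts) = of_real (prod_list (map (weight f h) ts))" for ts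
    by (induction ts) (use Suc in auto)
  then show ?case by simp
qed simp

lemma holomorphic_weight:
  assumes "\<And>n. (\<lambda>z. f z n) holomorphic_on A"
  shows "(\<lambda>z. weight (f z) h t) holomorphic_on A"
proof (induction h arbitrary: t)
  case (Suc h)
  have "(\<lambda>z. prod_list (map (weight (f z) h) ts)) holomorphic_on A" for ts
    by (induction ts) (use Suc in \<open>auto intro!: holomorphic_intros\<close>)
  then show ?case using assms by (auto intro!: holomorphic_intros)
qed simp

lemma tendsto_weight:
  fixes f :: "'b \<Rightarrow> nat \<Rightarrow> real"
  assumes "\<And>n. ((\<lambda>x. f x n) \<longlongrightarrow> g n) F"
  shows "((\<lambda>x. weight (f x) h t) \<longlongrightarrow> weight g h t) F"
proof (induction h arbitrary: t)
  case (Suc h)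
  have "((\<lambda>x. prod_list (map (weight (f x) h) ts)) \<longlongrightarrow> prod_list (map (weight g h) ts)) F" for ts
    by (induction ts) (use Suc in \<open>auto intro!: tendsto_mult\<close>)
  then show ?case using assms by (auto intro!: tendsto_mult)
qed simp

text \<open>A tree that is not fully grown has at least one node at each level.\<close>

lemma weight_scale_unfinished:
  fixes f :: "nat \<Rightarrow> real"
  assumes s: "1 \<le> s" and f: "\<And>n. 0 \<le> f n"
  shows "\<not> fully_grown h t \<Longrightarrow> s ^ h * weight f h t \<le> weight (\<lambda>n. s * f n) h t"
proof (induction h arbitrary: t)
  case (Suc h)
  let ?w = "weight f h" and ?W = "weight (\<lambda>n. s * f n) h"
  have fs: "0 \<le> f n \<and> f n \<le> s * f n" for n using s f[of n] by (simp add: mult_le_cancel_right1)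
  have w: "0 \<le> ?w u \<and> ?w u \<le> ?W u" for u by (rule weight_nonneg_mono) (rule fs)
  obtain u where u: "u \<in> set (kids t)" "\<not> fully_grown h u" using Suc.prems by auto
  \<comment> \<open>One unfinished child supplies the whole power of \<open>s\<close>; for its
    siblings the scaled weights are merely not smaller.\<close>
  have "s ^ h * prod_list (map ?w ts) \<le> prod_list (map ?W ts)" if "u \<in> set ts" for ts
    using that
  proof (induction ts)
    case (Cons v ts)
    have ts: "0 \<le> prod_list (map ?w ts) \<and> prod_list (map ?w ts) \<le> prod_list (map ?W ts)"
      by (rule prod_list_nonneg_mono) (rule w)
    show ?case
    proof (cases "u = v")
      case True
      have "(s ^ h * ?w v) * prod_list (map ?w ts) \<le> ?W v * prod_list (map ?W ts)"
        by (rule mult_mono) (use Suc.IH[OF u(2)] True ts w[of v] in auto)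
      then show ?thesis by (simp add: mult.assoc)
    next
      case False
      then have "s ^ h * prod_list (map ?w ts) \<le> prod_list (map ?W ts)" using Cons by auto
      then have "?w v * (s ^ h * prod_list (map ?w ts)) \<le> ?W v * prod_list (map ?W ts)"
        by (rule mult_mono[rotated]) (use w[of v] s ts in auto)
      then show ?thesis by (simp add: mult_ac)
    qed
  qed simp
  from this[OF u(1)] have "(s * f (length (kids t))) * (s ^ h * prod_list (map ?w (kids t))) \<le>
      (s * f (length (kids t))) * prod_list (map ?W (kids t))"
    by (rule mult_left_mono) (use s f in auto)
  then show ?case by (simp add: mult_ac)
qed simp

section \<open>Total weights of families of trees\<close>

lemma sum_prod_list_eq_power:
  fixes g :: "'b \<Rightarrow> real"
  assumes "finite F"
  shows "(\<Sum>ts | set ts \<subseteq> F \<and> length ts = n. prod_list (map g ts)) = (\<Sum>t\<in>F. g t) ^ n"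
proof (induction n)
  case 0
  have "{ts. set ts \<subseteq> F \<and> length ts = 0} = {[]}" by auto
  then show ?case by simp
next
  case (Suc n)
  let ?L = "{ts. set ts \<subseteq> F \<and> length ts = n}"
  have "{ts. set ts \<subseteq> F \<and> length ts = Suc n} = (\<lambda>(t, ts). t # ts) ` (F \<times> ?L)"
    by (auto simp: length_Suc_conv image_iff)
  moreover have "inj_on (\<lambda>(t, ts). t # ts) (F \<times> ?L)" by (auto simp: inj_on_def)
  ultimately have "(\<Sum>ts | set ts \<subseteq> F \<and> length ts = Suc n. prod_list (map g ts)) =
      (\<Sum>(t, ts)\<in>F \<times> ?L. g t * prod_list (map g ts))"
    by (simp add: sum.reindex case_prod_unfold)
  also have "\<dots> = (\<Sum>t\<in>F. g t) * (\<Sum>ts\<in>?L. prod_list (map g ts))"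
    unfolding sum_product sum.cartesian_product ..
  finally show ?case using Suc by simp
qed

text \<open>A finite set of lists has finitely many entries and bounded lengths, hence lies in a
  finite union of full powers of \<open>F\<close>, over each of which the sum factors. Working with
  bounds on all finite subsums avoids carrying summability along.\<close>

lemma sum_lists_le:
  fixes f :: "nat \<Rightarrow> real" and g :: "'b \<Rightarrow> real"
  assumes nonneg: "\<And>n. 0 \<le> f n" "\<And>t. 0 \<le> g t"
    and bound: "\<And>F. finite F \<Longrightarrow> F \<subseteq> T \<Longrightarrow> (\<Sum>t\<in>F. g t) \<le> C"
    and sums: "(\<lambda>n. f n * C ^ n) sums D"
    and G: "finite G" "G \<subseteq> lists T"
  shows "(\<Sum>ts\<in>G. f (length ts) * prod_list (map g ts)) \<le> D"
proof -
  define F where "F = (\<Union>ts\<in>G. set ts)"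
  define N where "N = Suc (Max (length ` G))"
  have F: "finite F" "F \<subseteq> T" using G by (auto simp: F_def)
  have prod_nonneg: "0 \<le> prod_list (map g ts)" for ts
    by (induction ts) (simp_all add: nonneg)
  have C: "0 \<le> C" using bound[of "{}"] by simp
  let ?L = "\<lambda>n. {ts. set ts \<subseteq> F \<and> length ts = n}"
  have L: "finite (?L n)" for n by (rule finite_lists_length_eq[OF F(1)])
  have "G \<subseteq> (\<Union>n<N. ?L n)"
    using G(1) by (auto simp: F_def N_def less_Suc_eq_le)
  then have "(\<Sum>ts\<in>G. f (length ts) * prod_list (map g ts)) \<le>
      (\<Sum>ts\<in>(\<Union>n<N. ?L n). f (length ts) * prod_list (map g ts))"
    by (intro sum_mono2) (use L nonneg prod_nonneg in auto)
  also have "\<dots> = (\<Sum>n<N. \<Sum>ts\<in>?L n. f (length ts) * prod_list (map g ts))"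
    by (rule sum.UNION_disjoint) (use L in auto)
  also have "\<dots> = (\<Sum>n<N. f n * (\<Sum>t\<in>F. g t) ^ n)"
    unfolding sum_prod_list_eq_power[OF F(1), symmetric] sum_distrib_left by (auto intro!: sum.cong)
  also have "\<dots> \<le> (\<Sum>n<N. f n * C ^ n)"
    by (intro sum_mono mult_left_mono power_mono bound F nonneg sum_nonneg)
  also have "\<dots> \<le> D"
    using sum_le_suminf[OF sums_summable[OF sums], of "{..<N}"] sums_unique[OF sums] nonneg(1) C by simp
  finally show ?thesis .
qed

definition scaled_poisson :: "real \<Rightarrow> real \<Rightarrow> nat \<Rightarrow> real" where
  "scaled_poisson s lam n = s * (lam ^ n / fact n * exp (- lam))"

lemma scaled_poisson_nonneg: "0 \<le> s \<Longrightarrow> 0 \<le> lam \<Longrightarrow> 0 \<le> scaled_poisson s lam n"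
  by (simp add: scaled_poisson_def)

text \<open>The value is \<open>s\<close> times the probability generating function of the Poisson
  law at \<open>C\<close>.\<close>

lemma scaled_poisson_sums:
  "(\<lambda>n. scaled_poisson s lam n * C ^ n) sums (s * exp (lam * (C - 1)))"
proof -
  have "(\<lambda>n. (lam * C) ^ n /\<^sub>R fact n) sums exp (lam * C)" by (rule exp_converges)
  then have "(\<lambda>n. (s * exp (- lam)) * ((lam * C) ^ n /\<^sub>R fact n)) sums ((s * exp (- lam)) * exp (lam * C))"
    by (rule sums_mult)
  moreover have "(s * exp (- lam)) * ((lam * C) ^ n /\<^sub>R fact n) = scaled_poisson s lam n * C ^ n" for n
    by (simp add: scaled_poisson_def field_simps)
  moreover have "(s * exp (- lam)) * exp (lam * C) = s * exp (lam * (C - 1))"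
    by (simp add: exp_add[symmetric] mult.assoc algebra_simps)
  ultimately show ?thesis by simp
qed

text \<open>
  The total weight of the truncated trees, when every node of depth less than \<open>h\<close> carries
  an additional factor \<open>s\<close>.
\<close>

primrec growth :: "real \<Rightarrow> real \<Rightarrow> nat \<Rightarrow> real" where
  "growth s lam 0 = 1"
| "growth s lam (Suc h) = s * exp (lam * (growth s lam h - 1))"

lemma growth_ge: "1 \<le> s \<Longrightarrow> 0 \<le> lam \<Longrightarrow> 1 \<le> growth s lam h"
proof (induction h)
  case (Suc h)
  then have "1 * 1 \<le> s * exp (lam * (growth s lam h - 1))"
    by (intro mult_mono) auto
  then show ?case by simp
qed simp

text \<open>The depth \<open>h\<close> is fixed and the limit is not uniform in it: for
  \<open>s\<close> > 1 and rate at least 1 the values of \<open>growth\<close> tend to infinity with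
  \<open>h\<close>.\<close>

lemma growth_tendsto:
  assumes "(s \<longlongrightarrow> 1) F" "(l \<longlongrightarrow> a) F"
  shows "((\<lambda>x. growth (s x) (l x) h) \<longlongrightarrow> 1) F"
proof (induction h)
  case (Suc h)
  have "((\<lambda>x. s x * exp (l x * (growth (s x) (l x) h - 1))) \<longlongrightarrow> 1 * exp (a * (1 - 1))) F"
    by (intro tendsto_mult tendsto_exp tendsto_diff tendsto_const assms Suc)
  then show ?case by simp
qed simp

lemma sum_Node_lists_le:
  assumes "0 \<le> s" "0 \<le> lam"
    and bound: "\<And>F. finite F \<Longrightarrow> F \<subseteq> T \<Longrightarrow> (\<Sum>t\<in>F. weight (scaled_poisson s lam) h t) \<le> C"
    and F: "finite F" "F \<subseteq> Node ` lists T"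
  shows "(\<Sum>t\<in>F. weight (scaled_poisson s lam) (Suc h) t) \<le> s * exp (lam * (C - 1))"
proof -
  have inj: "inj_on kids F" by (rule inj_onI) (rule plane.expand)
  have "(\<Sum>t\<in>F. weight (scaled_poisson s lam) (Suc h) t) =
      (\<Sum>ts\<in>kids ` F. scaled_poisson s lam (length ts) * prod_list (map (weight (scaled_poisson s lam) h) ts))"
    by (simp add: sum.reindex[OF inj])
  also have "\<dots> \<le> s * exp (lam * (C - 1))"
  proof (rule sum_lists_le[where T = T, OF _ _ bound scaled_poisson_sums])
    show "0 \<le> weight (scaled_poisson s lam) h t" for t
      using weight_nonneg_mono[of "scaled_poisson s lam" "scaled_poisson s lam"]
        scaled_poisson_nonneg[OF assms(1,2)] by blast
    show "kids ` F \<subseteq> lists T" using F(2) by auto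
  qed (use F scaled_poisson_nonneg[OF assms(1,2)] in auto)
  finally show ?thesis .
qed

lemma sum_trunc_trees_le:
  assumes "0 \<le> s" "0 \<le> lam"
  shows "finite F \<Longrightarrow> F \<subseteq> trunc_trees h \<Longrightarrow>
    (\<Sum>t\<in>F. weight (scaled_poisson s lam) h t) \<le> growth s lam h"
proof (induction h arbitrary: F)
  case 0
  then have "F = {} \<or> F = {Node []}" by auto
  then show ?case by auto
next
  case (Suc h)
  have "(\<Sum>t\<in>F. weight (scaled_poisson s lam) (Suc h) t) \<le> s * exp (lam * (growth s lam h - 1))"
    by (rule sum_Node_lists_le[OF assms Suc.IH]) (use Suc.prems in auto)
  then show ?case by simp
qed

text \<open>Truncated trees in which no complete occurrence of \<open>U\<close> has been seen.
  \<open>U\<close> is removed only at depths where it is fully grown, since otherwise the truncation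
  may conceal further descendants.\<close>

primrec avoiding :: "plane \<Rightarrow> nat \<Rightarrow> plane set" where
  "avoiding U 0 = {Node []}"
| "avoiding U (Suc h) = Node ` lists (avoiding U h) - {t. t = U \<and> fully_grown (Suc h) U}"

lemma avoiding_subset: "avoiding U h \<subseteq> trunc_trees h"
proof (induction h)
  case (Suc h)
  then have "lists (avoiding U h) \<subseteq> lists (trunc_trees h)" by (rule lists_mono)
  then show ?case by auto
qed simp

text \<open>Proper subtrees of \<open>U\<close> are too small to contain \<open>U\<close>. Hence
  \<open>U\<close> itself is among the candidates from which it is then removed, and the removal
  really saves its weight.\<close>

lemma smaller_in_avoiding: "fully_grown h t \<Longrightarrow> size t < size U \<Longrightarrow> t \<in> avoiding U h"
proof (induction h arbitrary: t)
  case (Suc h)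
  have "u \<in> avoiding U h" if "u \<in> set (kids t)" for u
  proof (rule Suc.IH)
    show "fully_grown h u" using Suc.prems that by simp
    have "size u < size t" using that by (cases t) (simp add: size_list_estimation' le_imp_less_Suc)
    then show "size u < size U" using Suc.prems by simp
  qed
  then have "Node (kids t) \<in> Node ` lists (avoiding U h)" by (intro imageI) auto
  then show ?case using Suc.prems(2) by auto
qed simp

text \<open>
  Each time a level is added, forbidding \<open>U\<close> removes the weight of \<open>U\<close>, which
  compensates for the factor \<open>s\<close>.
\<close>

lemma sum_avoiding_le:
  assumes s: "1 \<le> s" and lam: "0 \<le> lam" and U: "fully_grown h0 U"
    and small: "growth s lam h0 - weight (scaled_poisson 1 lam) h0 U \<le> 1"
    and h: "h0 \<le> h" and F: "finite F" "F \<subseteq> avoiding U h"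
  shows "(\<Sum>t\<in>F. weight (scaled_poisson s lam) h t) \<le> 1"
proof -
  let ?W = "weight (scaled_poisson s lam)"
  let ?p = "weight (scaled_poisson 1 lam) h0 U"
  have "0 \<le> s" using s by simp
  have p: "?p \<le> ?W h U" if "h0 \<le> h" for h
  proof -
    have "0 \<le> scaled_poisson 1 lam n \<and> scaled_poisson 1 lam n \<le> scaled_poisson s lam n" for n
      using mult_right_mono[OF s, of "scaled_poisson 1 lam n"] scaled_poisson_nonneg[of 1 lam n] lam
      by (simp add: scaled_poisson_def)
    then have "weight (scaled_poisson 1 lam) h U \<le> ?W h U" using weight_nonneg_mono by blast
    then show ?thesis unfolding weight_fully_grown[OF U that, of "scaled_poisson 1 lam"] .
  qed
  obtain h1 where h1: "h0 = Suc h1" using U by (cases h0) auto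
  \<comment> \<open>\<open>D\<close> bounds the sums over the candidates before \<open>U\<close> is
    removed. Enlarging \<open>F\<close> by \<open>U\<close> stays among the candidates, so the
    weight of \<open>U\<close> can be subtracted from \<open>D\<close>.\<close>
  have remove: "(\<Sum>t\<in>F. ?W (Suc h) t) \<le> D - ?p"
    if bound: "\<And>G. finite G \<Longrightarrow> G \<subseteq> Node ` lists T \<Longrightarrow> (\<Sum>t\<in>G. ?W (Suc h) t) \<le> D"
      and T: "avoiding U h \<subseteq> T" "U \<in> Node ` lists T" and h: "h0 \<le> Suc h"
      and F: "finite F" "F \<subseteq> avoiding U (Suc h)" for D T h F
  proof -
    have "fully_grown (Suc h) U" by (rule fully_grown_mono[OF U h])
    then have "U \<notin> F" "F \<subseteq> Node ` lists (avoiding U h)" using F(2) by auto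
    moreover from this lists_mono[OF T(1)] have "F \<subseteq> Node ` lists T" by blast
    then have "(\<Sum>t\<in>insert U F. ?W (Suc h) t) \<le> D" by (intro bound) (use F(1) T(2) in blast)+
    ultimately show ?thesis using F(1) p[OF h] by (simp del: weight.simps)
  qed
  have "finite F \<Longrightarrow> F \<subseteq> avoiding U h \<Longrightarrow> (\<Sum>t\<in>F. ?W h t) \<le> 1" for F
    using h
  proof (induction h arbitrary: F rule: dec_induct)
    case base
    have "(\<Sum>t\<in>F. ?W (Suc h1) t) \<le> growth s lam (Suc h1) - ?p"
    proof (rule remove[where T = "trunc_trees h1"])
      show "U \<in> Node ` lists (trunc_trees h1)"
        using fully_grown_imp_trunc_trees[OF U] h1 by simp
      show "(\<Sum>t\<in>G. ?W (Suc h1) t) \<le> growth s lam (Suc h1)"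
        if "finite G" "G \<subseteq> Node ` lists (trunc_trees h1)" for G
        using sum_trunc_trees_le[OF \<open>0 \<le> s\<close> lam that(1), of "Suc h1"] that(2) by simp
    qed (use base h1 avoiding_subset in auto)
    then show ?case using small h1 by simp
  next
    case (step n)
    \<comment> \<open>Total weight at most 1 one level lower gives at most \<open>s\<close> before
      the removal of \<open>U\<close>. Since \<open>s \<le> growth s lam h0\<close>, the smallness
      hypothesis of the base case serves here as well.\<close>
    have "(\<Sum>t\<in>F. ?W (Suc n) t) \<le> s * exp (lam * (1 - 1)) - ?p"
    proof (rule remove[where T = "avoiding U n"])
      have "u \<in> avoiding U n" if "u \<in> set (kids U)" for u
      proof (rule smaller_in_avoiding)
        show "fully_grown n u" using U h1 that step.hyps fully_grown_mono[of h1 u n] by simp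
        show "size u < size U" using that by (cases U) (simp add: size_list_estimation' le_imp_less_Suc)
      qed
      then have "Node (kids U) \<in> Node ` lists (avoiding U n)" by (intro imageI) auto
      then show "U \<in> Node ` lists (avoiding U n)" by simp
      show "(\<Sum>t\<in>G. ?W (Suc n) t) \<le> s * exp (lam * (1 - 1))"
        if "finite G" "G \<subseteq> Node ` lists (avoiding U n)" for G
        by (rule sum_Node_lists_le[OF \<open>0 \<le> s\<close> lam step.IH that])
    qed (use step in auto)
    moreover have "s \<le> growth s lam h0"
    proof -
      have "s * 1 \<le> s * exp (lam * (growth s lam h1 - 1))"
        by (rule mult_left_mono) (use growth_ge[OF s lam, of h1] lam s in auto)
      then show ?thesis using h1 by simp
    qed
    ultimately show ?case using small by simp
  qed
  then show ?thesis using F by blast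
qed

text \<open>In the limit \<open>growth\<close> is 1 while the weight of \<open>U\<close> stays
  positive, so there is room to spare. Both \<open>s\<close> and the rate vary, because enlarging a
  complex disc changes both.\<close>

lemma eventually_growth_small:
  assumes "fully_grown h0 U" "(s \<longlongrightarrow> 1) F" "(l \<longlongrightarrow> a) F" "0 < a"
  shows "\<forall>\<^sub>F x in F. growth (s x) (l x) h0 - weight (scaled_poisson 1 (l x)) h0 U \<le> 1"
proof -
  have lim: "((\<lambda>x. growth (s x) (l x) h0 - weight (scaled_poisson 1 (l x)) h0 U) \<longlongrightarrow>
      1 - weight (scaled_poisson 1 a) h0 U) F"
  proof (intro tendsto_diff growth_tendsto[OF assms(2,3)] tendsto_weight)
    fix n
    have "isCont (\<lambda>x. scaled_poisson 1 x n) a"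
      unfolding scaled_poisson_def by (intro continuous_intros) simp
    then show "((\<lambda>x. scaled_poisson 1 (l x) n) \<longlongrightarrow> scaled_poisson 1 a n) F"
      by (rule isCont_tendsto_compose) (rule assms(3))
  qed
  have "0 < weight (scaled_poisson 1 a) h0 U"
    by (rule weight_pos) (use assms(4) in \<open>simp add: scaled_poisson_def\<close>)
  then have "\<forall>\<^sub>F x in F. growth (s x) (l x) h0 - weight (scaled_poisson 1 (l x)) h0 U < 1"
    by (intro order_tendstoD(2)[OF lim]) simp
  then show ?thesis by (rule eventually_mono) simp
qed

lemma gw_trunc_in_avoiding:
  "(\<And>v. {p. is_address x i (v @ p)} \<noteq> addresses U) \<Longrightarrow> gw_trunc x h i \<in> avoiding U h"
proof (induction h arbitrary: i)
  case 0
  show ?case by simp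
next
  case (Suc h)
  have "gw_trunc x h (first_child x i + j) \<in> avoiding U h" if "j < x i" for j
  proof (rule Suc.IH)
    fix v show "{p. is_address x (first_child x i + j) (v @ p)} \<noteq> addresses U"
      using Suc.prems[of "j # v"] that by simp
  qed
  then have "map (gw_trunc x h) [first_child x i..<first_child x i + x i] \<in> lists (avoiding U h)"
    by (auto simp: in_lists_conv_set le_iff_add)
  moreover have "\<not> (gw_trunc x (Suc h) i = U \<and> fully_grown (Suc h) U)"
  proof
    assume *: "gw_trunc x (Suc h) i = U \<and> fully_grown (Suc h) U"
    have "is_address x i p \<longleftrightarrow> p \<in> addresses U" for p
    proof -
      \<comment> \<open>Once fully grown, the truncation no longer changes with depth, so the entire
        set of descendants would be that of \<open>U\<close>.\<close>
      have "gw_trunc x (Suc h + length p) i = gw_trunc x (Suc h) i"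
        by (rule fully_grown_gw_trunc) (use * in \<open>metis, simp\<close>)
      then have "gw_trunc x (Suc h + length p) i = U" using * by metis
      then show ?thesis using addresses_gw_trunc[of x "Suc h + length p" i] by auto
    qed
    then show False using Suc.prems[of "[]"] by auto
  qed
  ultimately show ?case by simp
qed


subsection \<open>Analyticity\<close>

lemma measure_disjoint_countable_has_sum:
  assumes "finite_measure M" and "countable K" and "disjoint_family_on X K"
    and X: "\<And>t. t \<in> K \<Longrightarrow> X t \<in> sets M"
  shows "((\<lambda>t. measure M (X t)) has_sum measure M (\<Union>t\<in>K. X t)) K"
proof -
  interpret finite_measure M by fact
  show ?thesis
  proof (cases "finite K")
    case True
    have "measure M (\<Union>t\<in>K. X t) = (\<Sum>t\<in>K. measure M (X t))"
      by (rule finite_measure_finite_Union) (use True X assms(3) in auto)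
    with True show ?thesis by simp
  next
    case False
    have bij: "bij_betw (from_nat_into K) UNIV K"
      by (rule bij_betw_from_nat_into) (use assms(2) False in auto)
    have K: "from_nat_into K n \<in> K" for n using bij by (auto simp: bij_betw_def)
    have "disjoint_family (\<lambda>n. X (from_nat_into K n))"
      unfolding disjoint_family_on_def
    proof (intro ballI impI)
      fix m n :: nat assume "m \<noteq> n"
      then have "from_nat_into K m \<noteq> from_nat_into K n"
        using bij by (auto simp: bij_betw_def inj_on_eq_iff)
      then show "X (from_nat_into K m) \<inter> X (from_nat_into K n) = {}"
        using assms(3) K by (auto simp: disjoint_family_on_def)
    qed
    then have "(\<lambda>n. measure M (X (from_nat_into K n))) sums measure M (\<Union>n. X (from_nat_into K n))"
      by (intro finite_measure_UNION) (use X K in auto)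
    moreover have "(\<Union>n. X (from_nat_into K n)) = (\<Union>t\<in>K. X t)"
      using bij by (metis bij_betw_def image_image)
    ultimately have "((\<lambda>n. measure M (X (from_nat_into K n))) has_sum measure M (\<Union>t\<in>K. X t)) UNIV"
      by (intro sums_nonneg_imp_has_sum) auto
    then show ?thesis using has_sum_reindex_bij_betw[OF bij] by blast
  qed
qed

text \<open>The depth may depend on the tree: a constant serves for balls, \<open>levels\<close> for
  complete finite trees. The second assumption makes the events disjoint.\<close>

lemma has_sum_gw_events:
  assumes "\<And>t. t \<in> K \<Longrightarrow> t \<in> trunc_trees (l t)"
    and "\<And>t u x. t \<in> K \<Longrightarrow> u \<in> K \<Longrightarrow> gw_trunc x (l t) 1 = t \<Longrightarrow> gw_trunc x (l u) 1 = u \<Longrightarrow> t = u"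
  shows "(\<Union>t\<in>K. gw_event lam (l t) t) \<in> sets (poisson_law lam)"
    and "((\<lambda>t. weight (pmf (poisson_pmf lam)) (l t) t) has_sum
      measure (poisson_law lam) (\<Union>t\<in>K. gw_event lam (l t) t)) K"
proof -
  interpret prob_space "poisson_law lam" by (rule prob_space_poisson_law)
  have meas: "gw_event lam (l t) t \<in> sets (poisson_law lam)" if "t \<in> K" for t
    by (rule measure_gw_event(1)) (rule assms(1)[OF that])
  have "countable K" by simp
  then show "(\<Union>t\<in>K. gw_event lam (l t) t) \<in> sets (poisson_law lam)"
    using meas by (intro sets.countable_UN') auto
  have "disjoint_family_on (\<lambda>t. gw_event lam (l t) t) K"
    unfolding disjoint_family_on_def gw_event_def using assms(2) by blast
  then have "((\<lambda>t. measure (poisson_law lam) (gw_event lam (l t) t)) has_sum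
      measure (poisson_law lam) (\<Union>t\<in>K. gw_event lam (l t) t)) K"
    by (intro measure_disjoint_countable_has_sum meas finite_measure_axioms) simp_all
  moreover have "measure (poisson_law lam) (gw_event lam (l t) t) = weight (pmf (poisson_pmf lam)) (l t) t"
    if "t \<in> K" for t
    by (rule measure_gw_event(2)) (rule assms(1)[OF that])
  ultimately show "((\<lambda>t. weight (pmf (poisson_pmf lam)) (l t) t) has_sum
      measure (poisson_law lam) (\<Union>t\<in>K. gw_event lam (l t) t)) K"
    by (simp cong: has_sum_cong)
qed

lemma pmf_poisson_eq_scaled_poisson: "0 < lam \<Longrightarrow> pmf (poisson_pmf lam) = scaled_poisson 1 lam"
  by (rule ext) (simp add: scaled_poisson_def)

text \<open>The Weierstrass test. On the disc of radius \<open>\<delta>\<close> about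
  \<open>a\<close>, \<open>exp (- z)\<close> has norm at most \<open>exp (\<delta> - a)\<close> and
  \<open>z ^ n\<close> at most \<open>(a + \<delta>) ^ n\<close>; relative to the Poisson mass at
  rate \<open>a + \<delta>\<close> this is an excess factor \<open>exp (2 * \<delta>)\<close> per
  node.\<close>

lemma real_analytic_onI_weight_sum:
  assumes bound: "\<And>a. 0 < a \<Longrightarrow> \<exists>\<delta>>0. \<exists>C. \<forall>F. finite F \<and> F \<subseteq> K \<longrightarrow>
      (\<Sum>t\<in>F. weight (scaled_poisson (exp (2 * \<delta>)) (a + \<delta>)) (l t) t) \<le> C"
    and sum: "\<And>lam. 0 < lam \<Longrightarrow> ((\<lambda>t. weight (pmf (poisson_pmf lam)) (l t) t) has_sum f lam) K"
  shows "real_analytic_on f {0<..}"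
  unfolding real_analytic_on_def
proof (intro ballI)
  fix a :: real assume "a \<in> {0<..}"
  then have a: "0 < a" by simp
  obtain \<delta> C where \<delta>: "0 < \<delta>" and C: "\<And>F. finite F \<Longrightarrow> F \<subseteq> K \<Longrightarrow>
      (\<Sum>t\<in>F. weight (scaled_poisson (exp (2 * \<delta>)) (a + \<delta>)) (l t) t) \<le> C"
    using bound[OF a] by blast
  define c where "c z n = exp (- z) * (z ^ n / fact n)" for z :: complex and n :: nat
  define M where "M t = weight (scaled_poisson (exp (2 * \<delta>)) (a + \<delta>)) (l t) t" for t
  define g where "g z = (\<Sum>\<^sub>\<infinity>t\<in>K. weight (c z) (l t) t)" for z
  have "0 \<le> M t" for t
    unfolding M_def
    using weight_nonneg_mono[of "scaled_poisson (exp (2 * \<delta>)) (a + \<delta>)"] a \<delta>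
    by (auto simp: scaled_poisson_nonneg)
  then have M: "M summable_on K"
    using C by (intro nonneg_bounded_partial_sums_imp_summable_on[where C = C]
        eventually_finite_subsets_at_top_weakI) (auto simp: M_def)
  have le: "norm (weight (c z) (l t) t) \<le> M t" if "z \<in> cball (of_real a) \<delta>" for t z
    unfolding M_def
  proof (rule norm_weight_le)
    fix n
    have z: "norm (z - of_real a) \<le> \<delta>" using that by (simp add: dist_norm norm_minus_commute)
    have "\<bar>Re (z - of_real a)\<bar> \<le> \<delta>" using abs_Re_le_cmod z by (rule order_trans)
    then have 1: "norm (exp (- z)) \<le> exp (\<delta> - a)" by (simp add: norm_exp_eq_Re)
    have "norm z \<le> a + \<delta>" using norm_triangle_ineq[of "of_real a" "z - of_real a"] z a by simp
    then have 2: "norm (z ^ n / fact n) \<le> (a + \<delta>) ^ n / fact n"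
      by (simp add: norm_divide norm_power divide_right_mono power_mono)
    have "norm (c z n) \<le> exp (\<delta> - a) * ((a + \<delta>) ^ n / fact n)"
      unfolding c_def norm_mult by (rule mult_mono[OF 1 2]) auto
    also have "exp (\<delta> - a) = exp (2 * \<delta>) * exp (- (a + \<delta>))" by (simp add: exp_add[symmetric])
    finally show "norm (c z n) \<le> scaled_poisson (exp (2 * \<delta>)) (a + \<delta>) n"
      by (simp add: scaled_poisson_def mult_ac)
  qed
  have ulim: "uniform_limit (cball (of_real a) \<delta>) (\<lambda>F z. \<Sum>t\<in>F. weight (c z) (l t) t) g (finite_subsets_at_top K)"
    unfolding g_def by (rule Weierstrass_m_test_general[OF le M])
  have hol: "(\<lambda>z. \<Sum>t\<in>F. weight (c z) (l t) t) holomorphic_on A" for F A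
  proof (intro holomorphic_on_sum holomorphic_weight)
    show "(\<lambda>z. c z n) holomorphic_on A" for n
      unfolding c_def by (intro holomorphic_intros) simp
  qed
  have "g holomorphic_on ball (of_real a) \<delta>"
  proof (rule holomorphic_uniform_limit[OF _ ulim])
    show "\<forall>\<^sub>F F in finite_subsets_at_top K. continuous_on (cball (of_real a) \<delta>) (\<lambda>z. \<Sum>t\<in>F. weight (c z) (l t) t) \<and>
        (\<lambda>z. \<Sum>t\<in>F. weight (c z) (l t) t) holomorphic_on ball (of_real a) \<delta>"
      using hol holomorphic_on_imp_continuous_on by (intro always_eventually) blast
  qed (auto simp: finite_subsets_at_top_neq_bot)
  then have "g analytic_on ball (of_real a) \<delta>" by (simp add: analytic_on_open)
  \<comment> \<open>Analyticity on a closed disc refers to an open neighbourhood, hence the halved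
    radius.\<close>
  then have "g analytic_on cball (of_real a) (\<delta> / 2)"
    by (rule analytic_on_subset) (use \<delta> in auto)
  moreover have "g (of_real lam) = of_real (f lam)" if "0 < lam" for lam
  proof -
    have "c (of_real lam) = (\<lambda>n. complex_of_real (pmf (poisson_pmf lam) n))"
      using that by (intro ext) (simp add: c_def exp_of_real flip: of_real_minus)
    then have "weight (c (of_real lam)) h t = of_real (weight (pmf (poisson_pmf lam)) h t)" for h t
      by (simp add: weight_of_real)
    then have "((\<lambda>t. weight (c (of_real lam)) (l t) t) has_sum of_real (f lam)) K"
      using has_sum_of_real[OF sum[OF that]] by simp
    then show ?thesis unfolding g_def by (rule infsumI)
  qed
  ultimately show "\<exists>\<delta>>0. \<exists>g. g analytic_on cball (complex_of_real a) \<delta> \<and>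
      (\<forall>t\<in>{0<..}. complex_of_real t \<in> cball (complex_of_real a) \<delta> \<longrightarrow> g (complex_of_real t) = complex_of_real (f t))"
    using \<delta> by (intro exI[of _ "\<delta> / 2"]) auto
qed

lemma real_analytic_on_add:
  assumes "real_analytic_on f S" "real_analytic_on g S"
  shows "real_analytic_on (\<lambda>x. f x + g x) S"
  unfolding real_analytic_on_def
proof
  fix a assume "a \<in> S"
  obtain d1 F where F: "0 < d1" "F analytic_on cball (complex_of_real a) d1"
    "\<And>t. t \<in> S \<Longrightarrow> complex_of_real t \<in> cball (complex_of_real a) d1 \<Longrightarrow> F (complex_of_real t) = complex_of_real (f t)"
    using assms(1) \<open>a \<in> S\<close> unfolding real_analytic_on_def by blast
  obtain d2 G where G: "0 < d2" "G analytic_on cball (complex_of_real a) d2"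
    "\<And>t. t \<in> S \<Longrightarrow> complex_of_real t \<in> cball (complex_of_real a) d2 \<Longrightarrow> G (complex_of_real t) = complex_of_real (g t)"
    using assms(2) \<open>a \<in> S\<close> unfolding real_analytic_on_def by blast
  have sub: "cball (complex_of_real a) (min d1 d2) \<subseteq> cball (complex_of_real a) d1"
    "cball (complex_of_real a) (min d1 d2) \<subseteq> cball (complex_of_real a) d2" by auto
  have "(\<lambda>z. F z + G z) analytic_on cball (complex_of_real a) (min d1 d2)"
    using F(2) G(2) sub by (intro analytic_on_add) (blast intro: analytic_on_subset)+
  moreover have "F (complex_of_real t) + G (complex_of_real t) = complex_of_real (f t + g t)"
    if "t \<in> S" "complex_of_real t \<in> cball (complex_of_real a) (min d1 d2)" for t
    using F(3)[OF that(1)] G(3)[OF that(1)] sub that(2) by auto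
  ultimately show "\<exists>\<delta>>0. \<exists>h. h analytic_on cball (complex_of_real a) \<delta> \<and>
      (\<forall>t\<in>S. complex_of_real t \<in> cball (complex_of_real a) \<delta> \<longrightarrow> h (complex_of_real t) = complex_of_real (f t + g t))"
    using F(1) G(1) by (intro exI[of _ "min d1 d2"] exI[of _ "\<lambda>z. F z + G z"] conjI) auto
qed

lemma real_analytic_on_minus:
  assumes "real_analytic_on f S"
  shows "real_analytic_on (\<lambda>x. - f x) S"
  unfolding real_analytic_on_def
proof
  fix a assume "a \<in> S"
  obtain d F where F: "0 < d" "F analytic_on cball (complex_of_real a) d"
    "\<And>t. t \<in> S \<Longrightarrow> complex_of_real t \<in> cball (complex_of_real a) d \<Longrightarrow> F (complex_of_real t) = complex_of_real (f t)"
    using assms \<open>a \<in> S\<close> unfolding real_analytic_on_def by blast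
  then show "\<exists>\<delta>>0. \<exists>h. h analytic_on cball (complex_of_real a) \<delta> \<and>
      (\<forall>t\<in>S. complex_of_real t \<in> cball (complex_of_real a) \<delta> \<longrightarrow> h (complex_of_real t) = complex_of_real (- f t))"
    by (intro exI[of _ d] exI[of _ "\<lambda>z. - F z"] conjI analytic_on_neg) auto
qed

section \<open>Probabilities of properties of the tree\<close>

abbreviation address_set :: "(nat \<Rightarrow> nat) \<Rightarrow> nat list set" where
  "address_set x \<equiv> {p. is_address x 1 p}"

text \<open>The counterpart of \<open>fully_grown_gw_trunc\<close> going upwards: if a deep
  truncation is finished within \<open>k\<close> levels, then cutting at \<open>k\<close> loses
  nothing.\<close>

lemma gw_trunc_eq_of_fully_grown:
  "fully_grown k (gw_trunc x h i) \<Longrightarrow> k \<le> h \<Longrightarrow> gw_trunc x k i = gw_trunc x h i"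
proof (induction k arbitrary: h i)
  case (Suc k)
  from Suc.prems(2) obtain m where m: "h = Suc m" "k \<le> m" by (cases h) auto
  have "gw_trunc x k j = gw_trunc x m j" if "j \<in> set [first_child x i..<first_child x i + x i]" for j
    by (rule Suc.IH[OF _ m(2)]) (use Suc.prems(1) m(1) that in simp)
  then have "map (gw_trunc x k) [first_child x i..<first_child x i + x i] =
      map (gw_trunc x m) [first_child x i..<first_child x i + x i]" by (rule map_cong[OF refl])
  with m show ?case by (simp only: gw_trunc.simps)
qed simp

text \<open>Levels are counted in vertices: a single vertex has one. At this depth the weight runs
  over all vertices, so it is the probability that the tree is \<open>t\<close>.\<close>

definition levels :: "plane \<Rightarrow> nat" where
  "levels t = (LEAST h. fully_grown h t)"

lemma fully_grown_levels: "fully_grown (levels t) t"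
  unfolding levels_def using fully_grown_exists by (rule LeastI_ex)

lemma levels_le: "fully_grown h t \<Longrightarrow> levels t \<le> h"
  unfolding levels_def by (rule Least_le)

lemma gw_trunc_levels:
  "gw_trunc x (levels t) 1 = t \<Longrightarrow> levels t \<le> h \<Longrightarrow> gw_trunc x h 1 = t"
  using fully_grown_gw_trunc[of "levels t" x 1 h] fully_grown_levels[of t] by metis

lemma address_set_levels:
  assumes "gw_trunc x (levels t) 1 = t"
  shows "address_set x = addresses t"
proof -
  have "p \<in> address_set x \<longleftrightarrow> p \<in> addresses t" for p
    using addresses_gw_trunc[of x "levels t + length p" 1] gw_trunc_levels[OF assms, of "levels t + length p"]
    by auto
  then show ?thesis by blast
qed

text \<open>An exponential Markov inequality: an unfinished tree has at least \<open>h\<close>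
  vertices of depth below \<open>h\<close> and so gains \<open>s ^ h\<close>, while the scaled total
  remains at most 1. Tall trees avoiding \<open>U\<close> are thus geometrically rare.\<close>

lemma prob_unfinished_avoiding_le:
  assumes U: "fully_grown h0 U" and lam: "0 < lam"
  obtains s where "1 < s"
    and "\<And>h. h0 \<le> h \<Longrightarrow> measure (poisson_law lam)
      (\<Union>t\<in>{t \<in> avoiding U h. \<not> fully_grown h t}. gw_event lam h t) \<le> (1 / s) ^ h"
proof -
  have "\<forall>\<^sub>F s in at_right 1. growth s lam h0 - weight (scaled_poisson 1 lam) h0 U \<le> 1"
    by (rule eventually_growth_small[OF U _ tendsto_const lam]) (rule tendsto_ident_at)
  moreover have "\<forall>\<^sub>F s in at_right (1::real). 1 < s" by (rule eventually_at_right_less)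
  ultimately have "\<forall>\<^sub>F s in at_right 1. growth s lam h0 - weight (scaled_poisson 1 lam) h0 U \<le> 1 \<and> 1 < s"
    by (rule eventually_conj)
  then obtain s where s: "growth s lam h0 - weight (scaled_poisson 1 lam) h0 U \<le> 1" "1 < s"
    using eventually_happens'[OF trivial_limit_at_right_real] by blast
  show thesis
  proof (rule that[OF s(2)])
    fix h assume h: "h0 \<le> h"
    let ?K = "{t \<in> avoiding U h. \<not> fully_grown h t}"
    have "((\<lambda>t. weight (pmf (poisson_pmf lam)) h t) has_sum
        measure (poisson_law lam) (\<Union>t\<in>?K. gw_event lam h t)) ?K"
      by (rule has_sum_gw_events(2)) (use avoiding_subset in auto)
    then show "measure (poisson_law lam) (\<Union>t\<in>?K. gw_event lam h t) \<le> (1 / s) ^ h"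
    proof (rule has_sum_le_finite_sums)
      fix F assume F: "finite F" "F \<subseteq> ?K"
      have scale: "(\<lambda>n. s * scaled_poisson 1 lam n) = scaled_poisson s lam"
        by (rule ext) (simp add: scaled_poisson_def)
      have "s ^ h * (\<Sum>t\<in>F. weight (pmf (poisson_pmf lam)) h t) =
          (\<Sum>t\<in>F. s ^ h * weight (scaled_poisson 1 lam) h t)"
        using lam by (simp add: sum_distrib_left pmf_poisson_eq_scaled_poisson)
      also have "\<dots> \<le> (\<Sum>t\<in>F. weight (scaled_poisson s lam) h t)"
        using weight_scale_unfinished[of s "scaled_poisson 1 lam" h] s(2) F lam
        by (intro sum_mono) (auto simp: scale scaled_poisson_nonneg)
      also have "\<dots> \<le> 1"
        by (rule sum_avoiding_le[OF _ _ U s(1) h]) (use s(2) lam F in auto)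
      finally show "(\<Sum>t\<in>F. weight (pmf (poisson_pmf lam)) h t) \<le> (1 / s) ^ h"
        using s(2) by (simp add: power_one_over field_simps)
    qed
  qed
qed

text \<open>Avoidance of \<open>U\<close> acts twice: it bounds the majorants on a complex disc, and
  at each real rate it shows that discarding the infinite trees costs no probability.\<close>

lemma real_analytic_on_prob_avoiding:
  assumes avoid: "\<And>x. P (address_set x) \<Longrightarrow> \<not> occurs U (address_set x)"
    and meas: "\<And>lam. {x \<in> space (poisson_law lam). P (address_set x)} \<in> sets (poisson_law lam)"
  shows "real_analytic_on (\<lambda>lam. measure (poisson_law lam) {x \<in> space (poisson_law lam). P (address_set x)}) {0<..}"
proof -
  obtain h0 where U: "fully_grown h0 U" using fully_grown_exists by blast
  \<comment> \<open>A finite tree determines the address set, so one witness \<open>x\<close>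
    decides \<open>P\<close> for every sequence whose tree is \<open>t\<close>.\<close>
  define K where "K = {t. \<exists>x. gw_trunc x (levels t) 1 = t \<and> P (address_set x)}"
  have in_avoiding: "gw_trunc x h 1 \<in> avoiding U h" if "P (address_set x)" for x h
  proof (rule gw_trunc_in_avoiding)
    show "{p. is_address x 1 (v @ p)} \<noteq> addresses U" for v
      using avoid[OF that] unfolding occurs_def by auto
  qed
  have K_avoiding: "t \<in> avoiding U h" if "t \<in> K" "levels t \<le> h" for t h
  proof -
    obtain x where "gw_trunc x (levels t) 1 = t" "P (address_set x)" using \<open>t \<in> K\<close> by (auto simp: K_def)
    with in_avoiding[of x h] gw_trunc_levels[OF _ that(2)] show ?thesis by simp
  qed
  show ?thesis
  proof (rule real_analytic_onI_weight_sum[where K = K and l = levels])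
    fix a :: real assume a: "0 < a"
    have "((\<lambda>\<delta>. exp (2 * \<delta>)) \<longlongrightarrow> exp (2 * 0)) (at_right (0::real))"
      by (intro tendsto_intros)
    then have e: "((\<lambda>\<delta>. exp (2 * \<delta>)) \<longlongrightarrow> 1) (at_right (0::real))" by simp
    have "((\<lambda>\<delta>. a + \<delta>) \<longlongrightarrow> a + 0) (at_right (0::real))"
      by (intro tendsto_intros)
    then have "((\<lambda>\<delta>. a + \<delta>) \<longlongrightarrow> a) (at_right (0::real))" by simp
    from eventually_growth_small[OF U e this a]
    have "\<forall>\<^sub>F \<delta> in at_right 0. growth (exp (2 * \<delta>)) (a + \<delta>) h0 - weight (scaled_poisson 1 (a + \<delta>)) h0 U \<le> 1 \<and> 0 < \<delta>"
      by (rule eventually_conj) (rule eventually_at_right_less)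
    then obtain \<delta> where small: "growth (exp (2 * \<delta>)) (a + \<delta>) h0 - weight (scaled_poisson 1 (a + \<delta>)) h0 U \<le> 1"
      and \<delta>: "0 < \<delta>"
      using eventually_happens'[OF trivial_limit_at_right_real] by blast
    have "(\<Sum>t\<in>F. weight (scaled_poisson (exp (2 * \<delta>)) (a + \<delta>)) (levels t) t) \<le> 1" if F: "finite F" "F \<subseteq> K" for F
    proof -
      \<comment> \<open>One depth for all trees in \<open>F\<close>; going beyond
        \<open>levels t\<close> leaves the weight of \<open>t\<close> unchanged.\<close>
      define h where "h = Max (insert h0 (levels ` F))"
      have h: "h0 \<le> h" "\<And>t. t \<in> F \<Longrightarrow> levels t \<le> h" unfolding h_def using F(1) by auto
      have "(\<Sum>t\<in>F. weight (scaled_poisson (exp (2 * \<delta>)) (a + \<delta>)) (levels t) t) =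
          (\<Sum>t\<in>F. weight (scaled_poisson (exp (2 * \<delta>)) (a + \<delta>)) h t)"
        by (intro sum.cong refl weight_fully_grown[symmetric] fully_grown_levels h(2))
      also have "\<dots> \<le> 1"
        by (rule sum_avoiding_le[OF _ _ U small h(1) F(1)]) (use \<delta> a K_avoiding h(2) F(2) in auto)
      finally show ?thesis .
    qed
    with \<delta> show "\<exists>\<delta>>0. \<exists>C. \<forall>F. finite F \<and> F \<subseteq> K \<longrightarrow>
        (\<Sum>t\<in>F. weight (scaled_poisson (exp (2 * \<delta>)) (a + \<delta>)) (levels t) t) \<le> C"
      by blast
  next
    fix lam :: real assume lam: "0 < lam"
    interpret prob_space "poisson_law lam" by (rule prob_space_poisson_law)
    let ?E = "{x \<in> space (poisson_law lam). P (address_set x)}"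
    let ?B = "\<Union>t\<in>K. gw_event lam (levels t) t"
    have unique: "t = u" if "gw_trunc x (levels t) 1 = t" "gw_trunc x (levels u) 1 = u" for t u x
      using gw_trunc_levels[OF that(1), of "max (levels t) (levels u)"]
        gw_trunc_levels[OF that(2), of "max (levels t) (levels u)"] by simp
    have B: "?B \<in> sets (poisson_law lam)"
      and sum: "((\<lambda>t. weight (pmf (poisson_pmf lam)) (levels t) t) has_sum measure (poisson_law lam) ?B) K"
      using has_sum_gw_events[of K levels lam] unique fully_grown_imp_trunc_trees[OF fully_grown_levels]
      by blast+
    have sub: "?B \<subseteq> ?E"
    proof
      fix x assume "x \<in> ?B"
      then obtain t y where "x \<in> space (poisson_law lam)" "gw_trunc x (levels t) 1 = t"
        "gw_trunc y (levels t) 1 = t" "P (address_set y)"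
        unfolding gw_event_def K_def by blast
      then show "x \<in> ?E" using address_set_levels[of x t] address_set_levels[of y t] by simp
    qed
    obtain s where s: "1 < s" "\<And>h. h0 \<le> h \<Longrightarrow> measure (poisson_law lam)
      (\<Union>t\<in>{t \<in> avoiding U h. \<not> fully_grown h t}. gw_event lam h t) \<le> (1 / s) ^ h"
      using prob_unfinished_avoiding_le[OF U lam] by blast
    have "measure (poisson_law lam) (?E - ?B) \<le> (1 / s) ^ h" if h: "h0 \<le> h" for h
    proof -
      \<comment> \<open>Outside \<open>?B\<close> the tree is unfinished at every depth, so
        \<open>h\<close> may tend to infinity in the estimate.\<close>
      have "?E - ?B \<subseteq> (\<Union>t\<in>{t \<in> avoiding U h. \<not> fully_grown h t}. gw_event lam h t)"
      proof
        fix x assume x: "x \<in> ?E - ?B"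
        let ?t = "gw_trunc x h 1"
        have "\<not> fully_grown h ?t"
        proof
          assume "fully_grown h ?t"
          then have "levels ?t \<le> h" by (rule levels_le)
          then have "gw_trunc x (levels ?t) 1 = ?t"
            by (rule gw_trunc_eq_of_fully_grown[OF fully_grown_levels])
          then have "x \<in> gw_event lam (levels ?t) ?t" "?t \<in> K"
            using x unfolding gw_event_def K_def by blast+
          with x show False by blast
        qed
        then show "x \<in> (\<Union>t\<in>{t \<in> avoiding U h. \<not> fully_grown h t}. gw_event lam h t)"
          using in_avoiding[of x h] x unfolding gw_event_def by blast
      qed
      then have "measure (poisson_law lam) (?E - ?B) \<le> measure (poisson_law lam)
          (\<Union>t\<in>{t \<in> avoiding U h. \<not> fully_grown h t}. gw_event lam h t)"
        by (rule finite_measure_mono) (rule has_sum_gw_events(1), use avoiding_subset in auto)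
      with s(2)[OF h] show ?thesis by linarith
    qed
    moreover have "(\<lambda>h. (1 / s) ^ h) \<longlonglongrightarrow> 0" by (rule LIMSEQ_realpow_zero) (use s(1) in auto)
    ultimately have "measure (poisson_law lam) (?E - ?B) \<le> 0"
      by (intro LIMSEQ_le_const) auto
    then have "measure (poisson_law lam) ?E = measure (poisson_law lam) ?B"
      using finite_measure_Diff[OF meas B sub] measure_nonneg[of "poisson_law lam" "?E - ?B"]
        finite_measure_mono[OF sub meas] by linarith
    with sum show "((\<lambda>t. weight (pmf (poisson_pmf lam)) (levels t) t) has_sum measure (poisson_law lam) ?E) K"
      by simp
  qed
qed

text \<open>At the fixed depth \<open>r\<close> the bound \<open>growth\<close> is finite for every
  factor and rate, so nothing has to be forbidden; the radius 1 chosen below is arbitrary.\<close>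

lemma prob_near_root:
  assumes near: "\<And>x y. (\<And>p. length p \<le> r \<Longrightarrow> p \<in> address_set x \<longleftrightarrow> p \<in> address_set y) \<Longrightarrow>
    Q (address_set x) \<longleftrightarrow> Q (address_set y)"
  shows "{x \<in> space (poisson_law lam). Q (address_set x)} \<in> sets (poisson_law lam)"
    and "real_analytic_on (\<lambda>lam. measure (poisson_law lam) {x \<in> space (poisson_law lam). Q (address_set x)}) {0<..}"
proof -
  define K where "K = {t. \<exists>x. gw_trunc x r 1 = t \<and> Q (address_set x)}"
  have K: "K \<subseteq> trunc_trees r" by (auto simp: K_def simp del: One_nat_def)
  have same: "Q (address_set x) \<longleftrightarrow> Q (address_set y)" if "gw_trunc x r 1 = gw_trunc y r 1" for x y
  proof (rule near)
    fix p :: "nat list" assume "length p \<le> r"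
    then show "p \<in> address_set x \<longleftrightarrow> p \<in> address_set y"
      using addresses_gw_trunc[of x r 1] addresses_gw_trunc[of y r 1] that by auto
  qed
  have eq: "{x \<in> space (poisson_law lam). Q (address_set x)} = (\<Union>t\<in>K. gw_event lam r t)" for lam
    unfolding K_def gw_event_def using same by blast
  have sum: "(\<Union>t\<in>K. gw_event lam r t) \<in> sets (poisson_law lam)"
    "((\<lambda>t. weight (pmf (poisson_pmf lam)) r t) has_sum measure (poisson_law lam) (\<Union>t\<in>K. gw_event lam r t)) K" for lam
    using has_sum_gw_events[of K "\<lambda>_. r" lam] K by auto
  show "{x \<in> space (poisson_law lam). Q (address_set x)} \<in> sets (poisson_law lam)"
    unfolding eq by (rule sum(1))
  show "real_analytic_on (\<lambda>lam. measure (poisson_law lam) {x \<in> space (poisson_law lam). Q (address_set x)}) {0<..}"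
    unfolding eq
  proof (rule real_analytic_onI_weight_sum[where l = "\<lambda>_. r", OF _ sum(2)])
    fix a :: real assume "0 < a"
    then have "(\<Sum>t\<in>F. weight (scaled_poisson (exp (2 * 1)) (a + 1)) r t) \<le> growth (exp (2 * 1)) (a + 1) r"
      if "finite F" "F \<subseteq> K" for F
      using that K by (intro sum_trunc_trees_le) auto
    then show "\<exists>\<delta>>0. \<exists>C. \<forall>F. finite F \<and> F \<subseteq> K \<longrightarrow> (\<Sum>t\<in>F. weight (scaled_poisson (exp (2 * \<delta>)) (a + \<delta>)) r t) \<le> C"
      by (intro exI[of _ 1]) auto
  qed
qed

theorem corollary1p6:
  fixes A :: "nat rtree \<Rightarrow> bool"
  assumes "first_order_property A"
  shows "real_analytic_on (prob_property A) {0<..}"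
proof -
  obtain \<phi> where \<phi>: "sentence \<phi>" and A: "\<And>T. rooted_tree T \<Longrightarrow> A T \<longleftrightarrow> models T \<phi>"
    using assms unfolding first_order_property_def by blast
  define P where "P S \<longleftrightarrow> sat (addr_tree S) (\<lambda>_. []) \<phi>" for S
  have AP: "A (bfs_tree x) \<longleftrightarrow> P (address_set x)" for x
    using A[OF rooted_tree_bfs_tree] sat_bfs_tree_iff[of x \<phi>] sentence_sat_iff_models[OF \<phi>]
    unfolding P_def by metis
  obtain U r where determined: "\<And>x y. occurs U (address_set x) \<Longrightarrow> occurs U (address_set y) \<Longrightarrow>
      (\<And>p. length p \<le> r \<Longrightarrow> p \<in> address_set x \<longleftrightarrow> p \<in> address_set y) \<Longrightarrow>
      P (address_set x) \<longleftrightarrow> P (address_set y)"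
    using sat_determined_near_root[OF \<phi>] plane_tree_is_address unfolding P_def by metis
  \<comment> \<open>\<open>Q\<close> reads off the ball what \<open>\<phi>\<close> would say if
    \<open>U\<close> occurred. It depends on the ball by construction, is defined also for trees
    without \<open>U\<close>, and agrees with \<open>P\<close> wherever \<open>U\<close>
    occurs.\<close>
  define Q where "Q S \<longleftrightarrow> (\<exists>y. occurs U (address_set y) \<and> P (address_set y) \<and>
      (\<forall>p. length p \<le> r \<longrightarrow> (p \<in> address_set y \<longleftrightarrow> p \<in> S)))" for S
  have PQ: "P (address_set x) \<longleftrightarrow> Q (address_set x)" if "occurs U (address_set x)" for x
    unfolding Q_def using determined[OF _ that] that by blast
  have near: "Q (address_set x) \<longleftrightarrow> Q (address_set y)"
    if "\<And>p. length p \<le> r \<Longrightarrow> p \<in> address_set x \<longleftrightarrow> p \<in> address_set y" for x y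
    unfolding Q_def using that by simp
  let ?prob = "\<lambda>R lam. measure (poisson_law lam) {x \<in> space (poisson_law lam). R (address_set x)}"
  have P_meas: "{x \<in> space (poisson_law lam). P (address_set x)} \<in> sets (poisson_law lam)" for lam
    using first_order_property_event[OF assms] unfolding AP .
  have Q_meas: "{x \<in> space (poisson_law lam). Q (address_set x)} \<in> sets (poisson_law lam)" for lam
    by (rule prob_near_root(1)) (rule near)
  have PQ_meas: "{x \<in> space (poisson_law lam). P (address_set x) \<and> \<not> Q (address_set x)} \<in> sets (poisson_law lam)"
    "{x \<in> space (poisson_law lam). Q (address_set x) \<and> \<not> P (address_set x)} \<in> sets (poisson_law lam)" for lam
    using P_meas Q_meas by (auto intro!: sets.sets_Collect_conj sets.sets_Collect_neg)
  have "real_analytic_on (?prob Q) {0<..}"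
    by (rule prob_near_root(2)) (rule near)
  \<comment> \<open>A disagreement between \<open>P\<close> and \<open>Q\<close> excludes
    \<open>U\<close>, which is the avoidance hypothesis for both differences.\<close>
  moreover have "real_analytic_on (?prob (\<lambda>S. P S \<and> \<not> Q S)) {0<..}"
    by (rule real_analytic_on_prob_avoiding[where U = U]) (use PQ PQ_meas in auto)
  moreover have "real_analytic_on (\<lambda>lam. - ?prob (\<lambda>S. Q S \<and> \<not> P S) lam) {0<..}"
    by (rule real_analytic_on_minus, rule real_analytic_on_prob_avoiding[where U = U]) (use PQ PQ_meas in auto)
  ultimately have "real_analytic_on (\<lambda>lam. ?prob Q lam + ?prob (\<lambda>S. P S \<and> \<not> Q S) lam + - ?prob (\<lambda>S. Q S \<and> \<not> P S) lam) {0<..}"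
    by (intro real_analytic_on_add)
  moreover have "?prob Q lam + ?prob (\<lambda>S. P S \<and> \<not> Q S) lam + - ?prob (\<lambda>S. Q S \<and> \<not> P S) lam = prob_property A lam" for lam
  proof -
    interpret prob_space "poisson_law lam" by (rule prob_space_poisson_law)
    let ?X = "{x \<in> space (poisson_law lam). P (address_set x)}"
    let ?Y = "{x \<in> space (poisson_law lam). Q (address_set x)}"
    have "{x \<in> space (poisson_law lam). P (address_set x) \<and> \<not> Q (address_set x)} = ?X - ?Y"
      "{x \<in> space (poisson_law lam). Q (address_set x) \<and> \<not> P (address_set x)} = ?Y - ?X" by blast+
    moreover have "prob (?X - ?Y) = prob ?X - prob (?X \<inter> ?Y)" "prob (?Y - ?X) = prob ?Y - prob (?X \<inter> ?Y)"
      using finite_measure_Diff'[OF P_meas Q_meas] finite_measure_Diff'[OF Q_meas P_meas]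
      by (simp_all only: Int_commute)
    ultimately show ?thesis unfolding prob_property_def AP by simp
  qed
  ultimately show ?thesis by simp
qed

end
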